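(* Let $n\in\mathbb{Z}_+$, $n-1<\alpha<n$, $a\in\mathbb{R}$, $\lambda\in\mathbb{R}$ with $\lambda\ne1$, and $b_0,\dots,b_{n-1}\in\mathbb{R}$. Let $y$ be the response of the zero-input discrete fractional order system $${}_a\nabla_k^{\alpha}y(k)=\lambda y(k),\quad k\in\mathbb{N}_{a+1},\qquad \nabla^{\kappa}y(k)\big|_{k=a}=b_\kappa,\ \ \kappa=0,1,\dots,n-1.$$ Then $y$ has the following properties. (i) For $\lambda>0$ and $\lambda\neq1$: if $\lambda<2^{\alpha}$, then $y(k)$ is divergent; and if $\lambda>2^{\alpha}$, then $y(k)$ is convergent. (ii) For $\lambda=0$: $y(k)=\sum_{\kappa=0}^{n-1}\frac{b_\kappa}{\kappa!}(k-a)^{\overline{\kappa}}$, and therefore $y(k)$ might be divergent or constant. (iii) For $\lambda<0$: if $0<\alpha\le 1$, then $y(k)$ is monotonically convergent; if $1<\alpha\le2$, then $y(k)$ is convergent, with a possible overshoot; if $\alpha>2$, then $y(k)$ is divergent when $|\lambda|<2^{\alpha}\cos^{\alpha}\!\left(\frac{\pi}{\alpha}\right)$, and $y(k)$ is convergent when $|\lambda|>2^{\alpha}\cos^{\alpha}\!\left(\frac{\pi}{\alpha}\right)$.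
   Context: Notation: $\mathbb{N}_{c}=\{c,c+1,c+2,\dots\}$. $\Gamma$ is the Gamma function, and $\binom{p}{q}=\frac{\Gamma(p+1)}{\Gamma(q+1)\Gamma(p-q+1)}$, so that for $j\in\mathbb{N}$, $\binom{p}{j}=\frac{p(p-1)\cdots(p-j+1)}{j!}$. Backward difference: $\nabla^n f(k)=\sum_{j=0}^{n}(-1)^j\binom{n}{j}f(k-j)$, with $\nabla^0 f=f$. Nabla fractional sum: for $\gamma>0$, $f:\mathbb{N}_{a+1}\to\mathbb{R}$ and $k\in\mathbb{N}_{a+1}$, ${}_a\nabla_k^{-\gamma}f(k)=\sum_{j=0}^{k-a-1}(-1)^j\binom{-\gamma}{j}f(k-j)$. Nabla Caputo fractional difference: for $n-1<\alpha<n$, $n\in\mathbb{Z}_+$, and $f:\mathbb{N}_{a-n}\to\mathbb{R}$, ${}_a\nabla_k^{\alpha}f(k)={}_a\nabla_k^{\alpha-n}\,\nabla^n f(k)$, i.e. the nabla fractional sum of order $n-\alpha$ of the function $\nabla^n f$. Rising function: $p^{\overline{q}}=\frac{\Gamma(p+q)}{\Gamma(p)}$. Convergence, divergence and monotonicity refer to the behaviour of the real sequence $y(k)$, $k\in\mathbb{N}_{a+1}$, as $k\to+\infty$: convergent means having a finite limit, divergent means not convergent. "Overshoot" means that the sequence passes its limiting value (changes sign, when the limit is $0$) before converging to it; "possible" means that it may or may not occur, depending on the initial values.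
   Formalization: Divergence in (i) and (iii) fails for b=0 (y=0 converges); it is proved when Σ b_κ p^{-κ} ≠ 0, with p=λ^{1/α} for λ>0 and p=|λ|^{1/α}e^{iπ/α} for λ<0, which excludes only a proper linear subspace of initial values. *)

theory Defs
  imports "HOL-Analysis.Analysis"
begin

definition Nfrom :: "real \<Rightarrow> real set" where
  "Nfrom c = {c + real i | i. True}"

definition nabla :: "nat \<Rightarrow> (real \<Rightarrow> real) \<Rightarrow> real \<Rightarrow> real" where
  "nabla n f k = (\<Sum>j = 0..n. (-1) ^ j * real (n choose j) * f (k - real j))"

text \<open>
  Nabla fractional sum of order \<open>\<gamma>\<close> based at \<open>a\<close>, intended for \<open>k \<in> Nfrom (a + 1)\<close>; there
  \<open>k - a - 1\<close> is a natural number, so the floor is exact.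
\<close>
definition nabla_fsum :: "real \<Rightarrow> real \<Rightarrow> (real \<Rightarrow> real) \<Rightarrow> real \<Rightarrow> real" where
  "nabla_fsum \<gamma> a f k =
     (\<Sum>j = 0..nat \<lfloor>k - a - 1\<rfloor>. (-1) ^ j * ((-\<gamma>) gchoose j) * f (k - real j))"

text \<open>Intended for \<open>n - 1 < \<alpha> < n\<close>.\<close>
definition nabla_caputo :: "nat \<Rightarrow> real \<Rightarrow> real \<Rightarrow> (real \<Rightarrow> real) \<Rightarrow> real \<Rightarrow> real" where
  "nabla_caputo n \<alpha> a f k = nabla_fsum (real n - \<alpha>) a (nabla n f) k"

definition rising :: "real \<Rightarrow> real \<Rightarrow> real" where
  "rising p q = Gamma (p + q) / Gamma p"

text \<open>
  Functions on a shifted copy of the naturals are total functions on the reals. Only the values of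
  \<open>y\<close> on \<open>Nfrom (a - n + 1)\<close> enter below; all others are unconstrained.
\<close>
definition is_response ::
    "nat \<Rightarrow> real \<Rightarrow> real \<Rightarrow> real \<Rightarrow> (nat \<Rightarrow> real) \<Rightarrow> (real \<Rightarrow> real) \<Rightarrow> bool" where
  "is_response n \<alpha> a lam b y \<longleftrightarrow>
     (\<forall>k \<in> Nfrom (a + 1). nabla_caputo n \<alpha> a y k = lam * y k) \<and>
     (\<forall>\<kappa> < n. nabla \<kappa> y a = b \<kappa>)"

definition tends_to_from :: "real \<Rightarrow> (real \<Rightarrow> real) \<Rightarrow> real \<Rightarrow> bool" where
  "tends_to_from c y L \<longleftrightarrow> (\<lambda>i. y (c + real i)) \<longlonglongrightarrow> L"

definition convergent_from :: "real \<Rightarrow> (real \<Rightarrow> real) \<Rightarrow> bool" where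
  "convergent_from c y \<longleftrightarrow> (\<exists>L. tends_to_from c y L)"

definition divergent_from :: "real \<Rightarrow> (real \<Rightarrow> real) \<Rightarrow> bool" where
  "divergent_from c y \<longleftrightarrow> \<not> convergent_from c y"

definition monotone_from :: "real \<Rightarrow> (real \<Rightarrow> real) \<Rightarrow> bool" where
  "monotone_from c y \<longleftrightarrow> mono_on (Nfrom c) y \<or> antimono_on (Nfrom c) y"

text \<open>The sequence converges and takes values strictly on both sides of its limit.\<close>
definition overshoots_from :: "real \<Rightarrow> (real \<Rightarrow> real) \<Rightarrow> bool" where
  "overshoots_from c y \<longleftrightarrow>
     (\<exists>L. tends_to_from c y L \<and>
        (\<exists>k \<in> Nfrom c. \<exists>l \<in> Nfrom c. y k < L \<and> L < y l))"

text \<open>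
  The response has the generating function
  \<open>\<Sum>i. y (a + 1 + i) * w ^ i = (\<Sum>\<kappa><n. b \<kappa> * s powr (\<alpha> - 1 - \<kappa>)) / (s powr \<alpha> - lam)\<close> with
  \<open>s = 1 - w\<close>. Its residue in \<open>s\<close> at a root \<open>s\<close> of \<open>s powr \<alpha> = lam\<close> is \<open>1 / \<alpha>\<close> times the quantity
  below, so the initial values excite the corresponding mode iff that quantity is nonzero.
  For \<open>n = 1\<close> it is just \<open>b 0\<close>.
\<close>
definition mode_amplitude :: "nat \<Rightarrow> (nat \<Rightarrow> real) \<Rightarrow> complex \<Rightarrow> complex" where
  "mode_amplitude n b s = (\<Sum>\<kappa><n. of_real (b \<kappa>) / s ^ \<kappa>)"

text \<open>
  The root of \<open>s powr \<alpha> = lam\<close> of least nonnegative argument: \<open>lam powr (1 / \<alpha>)\<close> for \<open>lam > 0\<close>, and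
  \<open>\<bar>lam\<bar> powr (1 / \<alpha>) * exp (\<i> * pi / \<alpha>)\<close> for \<open>lam < 0\<close> (a genuine principal-branch root when
  \<open>\<alpha> \<ge> 1\<close>).
\<close>
definition principal_root :: "real \<Rightarrow> real \<Rightarrow> complex" where
  "principal_root \<alpha> lam =
     of_real (\<bar>lam\<bar> powr (1 / \<alpha>)) * cis (if lam < 0 then pi / \<alpha> else 0)"

end

theory Submission
  imports Defs "HOL-Complex_Analysis.Laurent_Convergence"
begin

text \<open>
  Put \<open>Y = \<Sum>i. y (a + 1 + i) * w ^ i\<close> and \<open>s = 1 - w\<close>. Backward differences and fractional sums act on
  generating functions as multiplication by powers of \<open>s\<close>, so that \<open>y\<close> is a response iff it has the
  prescribed initial values and
  \<open>(s powr \<alpha> - lam) * Y = (\<Sum>\<kappa><n. b \<kappa> * s powr (\<alpha> - 1 - \<kappa>))\<close> (lemma \<open>is_response_iff_gf\<close>). Everything is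
  decided by the position of the roots of \<open>s powr \<alpha> = lam\<close> relative to the disc \<open>norm (s - 1) \<le> 1\<close>, the
  image of the unit disc of \<open>w\<close>.

  A root inside the open disc at which the right-hand side does not vanish contradicts the
  convergence of \<open>Y\<close> in the unit disc, hence the boundedness of \<open>y\<close> (\<open>excited_mode_imp_divergent\<close>). In
  polar coordinates the disc is \<open>norm s < 2 * cos (Arg s)\<close>, which yields the thresholds \<open>2 powr \<alpha>\<close> for the
  positive root and \<open>(2 * cos (pi / \<alpha>)) powr \<alpha>\<close> for the roots of argument \<open>\<plusminus> pi / \<alpha>\<close>.

  If the closed disc contains no root, \<open>y\<close> tends to \<open>0\<close>. The right-hand side has coefficients tending to
  \<open>0\<close>, because all its exponents exceed \<open>-1\<close>; and for \<open>\<alpha> > 1\<close> the reciprocal of \<open>s powr \<alpha> - lam\<close> has a bounded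
  derivative, hence absolutely summable coefficients by Parseval's identity
  (\<open>resolvent_coeffs_summable\<close>); convolving the two gives a null sequence (\<open>quotient_coeffs_tendsto_0\<close>).
  For \<open>lam > 2 powr \<alpha>\<close>, where \<open>\<alpha>\<close> may be small, the equation is first multiplied by a finite geometric sum
  that turns \<open>\<alpha>\<close> into a multiple exceeding \<open>1\<close> (\<open>pos_response_tendsto_0\<close>).

  For \<open>0 < \<alpha> < 1\<close> and \<open>lam < 0\<close>, both \<open>s powr (\<alpha> - 1)\<close> and the reciprocal of \<open>s powr \<alpha> - lam\<close> have
  nonnegative coefficients, which gives monotonicity and boundedness at once
  (\<open>order_below_one_monotone_convergent\<close>). For \<open>lam = 0\<close> the
  equation is solved by binomial series with exponents \<open>-1 - \<kappa>\<close>, that is, by the polynomials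
  \<open>\<Sum>\<kappa><n. b \<kappa> * (i + \<kappa> choose \<kappa>)\<close>, which converge only when constant.
\<close>

section \<open>Square-summable Taylor coefficients\<close>

lemma sum_powers_root_of_unity:
  fixes x :: complex
  assumes "x ^ N = 1" "x \<noteq> 1"
  shows "(\<Sum>k<N. x ^ k) = 0"
  using assms by (simp add: sum_gp_strict)

text \<open>
  The characters \<open>i \<mapsto> \<omega> ^ (k * i)\<close> of the cyclic group of order \<open>N\<close> are orthogonal. Averaging over roots
  of unity instead of integrating over the circle keeps Parseval's identity purely algebraic.
\<close>
lemma discrete_parseval:
  fixes q :: "nat \<Rightarrow> complex" and N :: nat
  assumes N: "N > 0"
  defines "\<omega> \<equiv> exp (2 * of_real pi * \<i> / of_nat N) :: complex"
  shows "(\<Sum>k<N. (norm (\<Sum>i<N. q i * (\<omega> ^ k) ^ i))\<^sup>2) = real N * (\<Sum>i<N. (norm (q i))\<^sup>2)"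
proof -
  have w: "cnj (\<omega> ^ j) * \<omega> ^ j = 1" for j
    by (simp add: \<omega>_def exp_of_nat_mult [symmetric] exp_cnj exp_add [symmetric])
  have wN: "\<omega> ^ N = 1"
    using N by (simp add: \<omega>_def exp_of_nat_mult [symmetric])
  have orth: "(\<Sum>k<N. (\<omega> ^ k) ^ i * cnj ((\<omega> ^ k) ^ j)) = (if i = j then of_nat N else 0)"
    if ij: "i < N" "j < N" for i j
  proof -
    have eq: "(\<omega> ^ k) ^ i * cnj ((\<omega> ^ k) ^ j) = (\<omega> ^ i * cnj (\<omega> ^ j)) ^ k" for k
      by (simp add: power_mult_distrib power_mult [symmetric] mult.commute)
    show ?thesis
    proof (cases "i = j")
      case True
      then show ?thesis unfolding eq using w[of j] by (simp add: mult.commute)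
    next
      case False
      have "(\<omega> ^ i * cnj (\<omega> ^ j)) ^ N = (\<omega> ^ N) ^ i * cnj ((\<omega> ^ N) ^ j)"
        by (simp add: power_mult_distrib power_mult [symmetric] mult.commute)
      hence 1: "(\<omega> ^ i * cnj (\<omega> ^ j)) ^ N = 1" by (simp add: wN)
      have 2: "\<omega> ^ i * cnj (\<omega> ^ j) \<noteq> 1"
      proof
        assume *: "\<omega> ^ i * cnj (\<omega> ^ j) = 1"
        have "\<omega> ^ i = \<omega> ^ i * (cnj (\<omega> ^ j) * \<omega> ^ j)" by (simp only: w mult_1_right)
        also have "\<dots> = \<omega> ^ j" using * by (simp only: mult.assoc [symmetric] mult_1_left)
        finally have "exp (2 * of_real pi * \<i> * of_nat i / of_nat N) =
            exp (2 * of_real pi * \<i> * of_nat j / of_nat N)"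
          by (simp add: \<omega>_def exp_of_nat_mult [symmetric] mult_ac)
        hence "i mod N = j mod N"
          using complex_root_unity_eq[of N i j] N by (simp add: cong_def)
        thus False using ij False by simp
      qed
      show ?thesis unfolding eq using sum_powers_root_of_unity[OF 1 2] False by simp
    qed
  qed
  have "of_real (\<Sum>k<N. (norm (\<Sum>i<N. q i * (\<omega> ^ k) ^ i))\<^sup>2) =
      (\<Sum>k<N. (\<Sum>i<N. q i * (\<omega> ^ k) ^ i) * cnj (\<Sum>j<N. q j * (\<omega> ^ k) ^ j))"
    by (simp only: of_real_sum complex_norm_square)
  also have "\<dots> = (\<Sum>k<N. \<Sum>i<N. \<Sum>j<N. q i * cnj (q j) * ((\<omega> ^ k) ^ i * cnj ((\<omega> ^ k) ^ j)))"
    by (simp add: sum_product mult_ac)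
  also have "\<dots> = (\<Sum>i<N. \<Sum>j<N. \<Sum>k<N. q i * cnj (q j) * ((\<omega> ^ k) ^ i * cnj ((\<omega> ^ k) ^ j)))"
    by (subst sum.swap, rule sum.cong [OF refl], rule sum.swap)
  also have "\<dots> = (\<Sum>i<N. \<Sum>j<N. q i * cnj (q j) * (if i = j then of_nat N else 0))"
    by (intro sum.cong refl) (simp only: sum_distrib_left [symmetric] orth lessThan_iff)
  also have "\<dots> = (\<Sum>i<N. q i * cnj (q i) * of_nat N)"
    by (simp add: if_distrib cong: if_cong)
  also have "\<dots> = of_real (real N * (\<Sum>i<N. (norm (q i))\<^sup>2))"
    by (simp only: of_real_mult of_real_sum complex_norm_square sum_distrib_left
        of_real_of_nat_eq mult.commute)
  finally show ?thesis by (simp only: of_real_eq_iff)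
qed

text \<open>
  Parseval's identity, applied on a circle of radius \<open>r < 1\<close> to a partial sum long enough to be within \<open>1\<close>
  of \<open>F\<close> there, bounds the weighted sum of squares by \<open>(M + 1)\<^sup>2\<close>, uniformly in \<open>r\<close>; then \<open>r\<close> tends to \<open>1\<close>.
\<close>
lemma bounded_imp_square_summable_coeffs:
  fixes F :: "complex fps"
  assumes conv: "fps_conv_radius F \<ge> 1"
    and bound: "\<And>w. norm w < 1 \<Longrightarrow> norm (eval_fps F w) \<le> M"
  shows "summable (\<lambda>i. (norm (fps_nth F i))\<^sup>2)"
proof -
  have r_bound: "(\<Sum>i<K. (norm (fps_nth F i))\<^sup>2 * (r ^ i)\<^sup>2) \<le> (M + 1)\<^sup>2"
    if r: "0 < r" "r < 1" for r :: real and K :: nat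
  proof -
    have "ereal (norm (of_real r :: complex)) < fps_conv_radius F"
      using r by (intro less_le_trans[OF _ conv]) simp
    hence summ: "summable (\<lambda>i. norm (fps_nth F i) * r ^ i)"
      using norm_summable_fps[of "of_real r" F] r by (simp add: norm_mult norm_power)
    have "(\<lambda>N. \<Sum>i. norm (fps_nth F (i + N)) * r ^ (i + N)) \<longlonglongrightarrow> 0"
      by (rule suminf_exist_split2 [OF summ])
    hence "\<forall>\<^sub>F N in sequentially. (\<Sum>i. norm (fps_nth F (i + N)) * r ^ (i + N)) < 1"
      by (rule order_tendstoD) simp
    moreover have "\<forall>\<^sub>F N in sequentially. N \<ge> max K 1" by (rule eventually_ge_at_top)
    ultimately obtain N where tail: "(\<Sum>i. norm (fps_nth F (i + N)) * r ^ (i + N)) < 1"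
      and N: "N \<ge> K" "N > 0"
      using eventually_happens[OF eventually_conj] by fastforce
    have part: "norm (\<Sum>i<N. fps_nth F i * w ^ i) \<le> M + 1" if w: "norm w = r" for w
    proof -
      have conv_w: "ereal (norm w) < fps_conv_radius F"
        using r w by (intro less_le_trans[OF _ conv]) simp
      have sw: "summable (\<lambda>i. norm (fps_nth F (i + N) * w ^ (i + N)))"
        using summable_ignore_initial_segment[OF norm_summable_fps[OF conv_w]] by simp
      have "eval_fps F w = (\<Sum>i. fps_nth F (i + N) * w ^ (i + N)) + (\<Sum>i<N. fps_nth F i * w ^ i)"
        unfolding eval_fps_def by (rule suminf_split_initial_segment[OF summable_fps[OF conv_w]])
      hence "(\<Sum>i<N. fps_nth F i * w ^ i) = eval_fps F w - (\<Sum>i. fps_nth F (i + N) * w ^ (i + N))"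
        by simp
      also have "norm \<dots> \<le> norm (eval_fps F w) + norm (\<Sum>i. fps_nth F (i + N) * w ^ (i + N))"
        by (rule norm_triangle_ineq4)
      also have "norm (\<Sum>i. fps_nth F (i + N) * w ^ (i + N)) \<le> (\<Sum>i. norm (fps_nth F (i + N)) * r ^ (i + N))"
        using summable_norm[OF sw] w by (simp add: norm_mult norm_power)
      also have "norm (eval_fps F w) \<le> M" using bound w r by simp
      finally show ?thesis using tail by linarith
    qed
    define \<omega> where "\<omega> = (exp (2 * of_real pi * \<i> / of_nat N) :: complex)"
    have w1: "norm (\<omega> ^ k) = 1" for k by (simp add: \<omega>_def norm_power norm_exp_eq_Re)
    have "real N * (\<Sum>i<N. (norm (fps_nth F i))\<^sup>2 * (r ^ i)\<^sup>2) =
        real N * (\<Sum>i<N. (norm (fps_nth F i * of_real r ^ i))\<^sup>2)"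
      using r by (simp add: norm_mult norm_power power_mult_distrib)
    also have "\<dots> = (\<Sum>k<N. (norm (\<Sum>i<N. fps_nth F i * of_real r ^ i * (\<omega> ^ k) ^ i))\<^sup>2)"
      unfolding \<omega>_def by (rule discrete_parseval [symmetric]) fact
    also have "\<dots> = (\<Sum>k<N. (norm (\<Sum>i<N. fps_nth F i * (of_real r * \<omega> ^ k) ^ i))\<^sup>2)"
      by (simp add: power_mult_distrib mult.assoc)
    also have "\<dots> \<le> (\<Sum>k<N. (M + 1)\<^sup>2)"
      using r by (intro sum_mono power_mono part) (simp_all add: norm_mult w1)
    finally have "(\<Sum>i<N. (norm (fps_nth F i))\<^sup>2 * (r ^ i)\<^sup>2) \<le> (M + 1)\<^sup>2"
      using N by simp
    moreover have "(\<Sum>i<K. (norm (fps_nth F i))\<^sup>2 * (r ^ i)\<^sup>2) \<le> (\<Sum>i<N. (norm (fps_nth F i))\<^sup>2 * (r ^ i)\<^sup>2)"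
      using N by (intro sum_mono2) auto
    ultimately show ?thesis by linarith
  qed
  \<comment> \<open>Finitely many summands depend continuously on \<open>r\<close>, so \<open>r\<close> may tend to \<open>1\<close>.\<close>
  have "(\<Sum>i<K. (norm (fps_nth F i))\<^sup>2) \<le> (M + 1)\<^sup>2" for K
  proof (rule tendsto_upperbound)
    show "((\<lambda>r. \<Sum>i<K. (norm (fps_nth F i))\<^sup>2 * (r ^ i)\<^sup>2) \<longlongrightarrow> (\<Sum>i<K. (norm (fps_nth F i))\<^sup>2)) (at_left (1::real))"
      by (auto intro!: tendsto_eq_intros)
    show "\<forall>\<^sub>F r in at_left 1. (\<Sum>i<K. (norm (fps_nth F i))\<^sup>2 * (r ^ i)\<^sup>2) \<le> (M + 1)\<^sup>2"
      using eventually_at_left_real[of 0 "1::real"]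
      by (auto elim!: eventually_mono intro!: r_bound)
  qed simp
  thus ?thesis by (intro summableI_nonneg_bounded) auto
qed

text \<open>
  The coefficients of \<open>F'\<close> are \<open>(i + 1) * f (i + 1)\<close>, and they are square-summable. Since
  \<open>1 / (i + 1)\<close> is square-summable too, the products \<open>f (i + 1)\<close> are absolutely summable by
  \<open>2 * u * v \<le> u\<^sup>2 + v\<^sup>2\<close>.
\<close>
lemma bounded_deriv_imp_summable_coeffs:
  fixes F :: "complex fps"
  assumes conv: "fps_conv_radius F \<ge> 1"
    and bound: "\<And>w. norm w < 1 \<Longrightarrow> norm (eval_fps (fps_deriv F) w) \<le> M"
  shows "summable (\<lambda>i. norm (fps_nth F i))"
proof -
  have "summable (\<lambda>i. (norm (fps_nth (fps_deriv F) i))\<^sup>2)"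
    by (rule bounded_imp_square_summable_coeffs[OF order.trans[OF conv fps_conv_radius_deriv] bound])
  moreover have "summable (\<lambda>i. inverse (real (Suc i) ^ 2))"
    by (subst summable_Suc_iff) (rule inverse_power_summable, simp)
  ultimately have "summable (\<lambda>i. inverse (real (Suc i) ^ 2) + (norm (fps_nth (fps_deriv F) i))\<^sup>2)"
    by (intro summable_add)
  moreover have "norm (norm (fps_nth F (Suc i))) \<le>
      inverse (real (Suc i) ^ 2) + (norm (fps_nth (fps_deriv F) i))\<^sup>2" for i
  proof -
    define u v where "u = inverse (real (Suc i))" and "v = real (Suc i) * norm (fps_nth F (Suc i))"
    have "norm (norm (fps_nth F (Suc i))) = u * v" by (simp add: u_def v_def)
    also have "u * v \<le> u\<^sup>2 + v\<^sup>2"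
    proof -
      have "u * v \<ge> 0" unfolding u_def v_def by (intro mult_nonneg_nonneg) auto
      thus ?thesis using sum_squares_bound[of u v] by linarith
    qed
    also have "\<dots> = inverse (real (Suc i) ^ 2) + (norm (fps_nth (fps_deriv F) i))\<^sup>2"
      by (simp add: u_def v_def norm_mult power_inverse del: of_nat_Suc)
    finally show ?thesis .
  qed
  ultimately have "summable (\<lambda>i. norm (fps_nth F (Suc i)))"
    by (rule summable_comparison_test')
  thus ?thesis by (subst (asm) summable_Suc_iff)
qed

text \<open>
  Each summand tends to \<open>0\<close> for fixed \<open>j\<close> and is dominated by a constant multiple of \<open>norm (g j)\<close>, so
  Tannery's theorem applies. The summands with \<open>j > n\<close> are set to \<open>0\<close> to obtain an infinite series.
\<close>
lemma convolution_tendsto_0: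
  fixes g c :: "nat \<Rightarrow> complex"
  assumes g: "summable (\<lambda>i. norm (g i))" and c: "c \<longlonglongrightarrow> 0"
  shows "(\<lambda>n. \<Sum>j=0..n. g j * c (n - j)) \<longlonglongrightarrow> 0"
proof -
  obtain B where B: "\<And>i. norm (c i) \<le> B"
    using c by (meson convergentI convergent_imp_Bseq BseqE)
  have B0: "B \<ge> 0" using B[of 0] norm_ge_zero order_trans by blast
  define t where "t j n = (if j \<le> n then g j * c (n - j) else 0)" for j n
  have "(\<lambda>n. \<Sum>j. t j n) \<longlonglongrightarrow> (\<Sum>j::nat. 0 :: complex)"
  proof (rule tannerys_theorem [THEN conjunct2, THEN conjunct2])
    fix j
    have "(\<lambda>n. g j * c n) \<longlonglongrightarrow> 0" using tendsto_mult_right_zero[OF c] by simp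
    hence "(\<lambda>n. t j (n + j)) \<longlonglongrightarrow> 0" by (simp add: t_def)
    thus "t j \<longlonglongrightarrow> 0" by (rule LIMSEQ_offset)
  next
    show "\<forall>\<^sub>F (j, n) in at_top \<times>\<^sub>F at_top. norm (t j n) \<le> norm (g j) * B"
      using B0 by (intro always_eventually) (auto simp: t_def norm_mult intro!: mult_left_mono B)
  next
    show "summable (\<lambda>j. norm (g j) * B)" by (intro summable_mult2 g)
  qed simp
  moreover have "(\<Sum>j. t j n) = (\<Sum>j=0..n. g j * c (n - j))" for n
    by (subst suminf_finite[of "{0..n}"]) (auto simp: t_def)
  ultimately show ?thesis by simp
qed

section \<open>The power series of \<open>(1 - w) powr \<beta>\<close>\<close>

definition one_minus_pow :: "'a :: field_char_0 \<Rightarrow> 'a fps" where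
  "one_minus_pow \<beta> = Abs_fps (\<lambda>i. (-1) ^ i * (\<beta> gchoose i))"

lemma one_minus_pow_nth: "fps_nth (one_minus_pow \<beta>) i = (-1) ^ i * (\<beta> gchoose i)"
  by (simp add: one_minus_pow_def)

lemma one_minus_pow_nth_0 [simp]: "fps_nth (one_minus_pow \<beta>) 0 = 1"
  by (simp add: one_minus_pow_nth)

lemma one_minus_pow_nth_Suc:
  "of_nat (Suc i) * fps_nth (one_minus_pow \<beta>) (Suc i) = (of_nat i - \<beta>) * fps_nth (one_minus_pow \<beta>) i"
proof -
  have "of_nat (Suc i) * (\<beta> gchoose Suc i) = (\<beta> - of_nat i) * (\<beta> gchoose i)"
    using gbinomial_mult_1[of \<beta> i] by (simp add: algebra_simps)
  moreover have "of_nat (Suc i) * fps_nth (one_minus_pow \<beta>) (Suc i) =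
      - ((-1) ^ i * (of_nat (Suc i) * (\<beta> gchoose Suc i)))"
    by (simp only: one_minus_pow_nth power_Suc) (simp add: mult_ac)
  ultimately have "of_nat (Suc i) * fps_nth (one_minus_pow \<beta>) (Suc i) =
      - ((-1) ^ i * ((\<beta> - of_nat i) * (\<beta> gchoose i)))"
    by (simp only:)
  thus ?thesis unfolding one_minus_pow_nth[of \<beta> i] by (simp add: algebra_simps)
qed

lemma one_minus_pow_0 [simp]: "one_minus_pow 0 = 1"
proof (rule fps_ext)
  fix i show "fps_nth (one_minus_pow 0 :: 'a fps) i = fps_nth 1 i"
    by (cases i) (simp_all add: one_minus_pow_nth)
qed

lemma one_minus_pow_1: "one_minus_pow 1 = 1 - fps_X"
proof (rule fps_ext)
  fix i :: nat
  have "(1 :: 'a) gchoose i = of_nat (1 choose i)"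
    using binomial_gbinomial[where 'a='a, of 1 i] by (metis of_nat_1)
  then show "fps_nth (one_minus_pow 1 :: 'a fps) i = fps_nth (1 - fps_X) i"
    by (cases i; cases "i - 1") (auto simp: one_minus_pow_nth)
qed

lemma one_minus_pow_add: "one_minus_pow (\<beta> + \<gamma>) = one_minus_pow \<beta> * one_minus_pow \<gamma>"
proof (rule fps_ext)
  fix n :: nat
  have "fps_nth (one_minus_pow \<beta> * one_minus_pow \<gamma>) n =
      (\<Sum>i=0..n. (-1) ^ n * ((\<beta> gchoose i) * (\<gamma> gchoose (n - i))))"
    unfolding fps_mult_nth
  proof (intro sum.cong refl)
    fix i assume "i \<in> {0..n}"
    hence "(-1 :: 'a) ^ n = (-1) ^ i * (-1) ^ (n - i)" by (simp flip: power_add)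
    thus "fps_nth (one_minus_pow \<beta>) i * fps_nth (one_minus_pow \<gamma>) (n - i) =
        (-1) ^ n * ((\<beta> gchoose i) * (\<gamma> gchoose (n - i)))"
      by (simp add: one_minus_pow_nth)
  qed
  thus "fps_nth (one_minus_pow (\<beta> + \<gamma>)) n = fps_nth (one_minus_pow \<beta> * one_minus_pow \<gamma>) n"
    by (simp add: one_minus_pow_nth gbinomial_Vandermonde flip: sum_distrib_left)
qed

lemma one_minus_pow_power: "one_minus_pow \<beta> ^ q = one_minus_pow (of_nat q * \<beta>)"
  by (induction q) (simp_all add: algebra_simps one_minus_pow_add)

text \<open>
  By Gamma function asymptotics the coefficients have size \<open>n powr (- \<beta> - 1)\<close>. This is where the
  lower bound on the exponent enters.
\<close>
lemma one_minus_pow_tendsto_0: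
  fixes \<beta> :: real
  assumes "\<beta> > -1"
  shows "fps_nth (one_minus_pow \<beta>) \<longlonglongrightarrow> 0"
proof -
  have "(\<lambda>n. (\<beta> gchoose n) / ((-1) ^ n / exp ((\<beta> + 1) * of_real (ln (real n))))) \<longlonglongrightarrow>
      inverse (Gamma (- \<beta>))"
    by (rule gbinomial_asymptotic)
  moreover have "filterlim (\<lambda>n. (\<beta> + 1) * ln (real n)) at_top sequentially"
    using assms by (intro filterlim_tendsto_pos_mult_at_top[OF tendsto_const] 
        filterlim_compose[OF ln_at_top filterlim_real_sequentially]) simp
  hence "(\<lambda>n. exp (- ((\<beta> + 1) * ln (real n)))) \<longlonglongrightarrow> 0"
    by (intro filterlim_compose[OF exp_at_bot] filterlim_uminus_at_bot_at_top[THEN filterlim_compose])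
  ultimately have "(\<lambda>n. (\<beta> gchoose n) / ((-1) ^ n / exp ((\<beta> + 1) * of_real (ln (real n)))) *
      exp (- ((\<beta> + 1) * ln (real n)))) \<longlonglongrightarrow> inverse (Gamma (- \<beta>)) * 0"
    by (rule tendsto_mult)
  moreover have "(\<beta> gchoose n) / ((-1) ^ n / exp ((\<beta> + 1) * of_real (ln (real n)))) *
      exp (- ((\<beta> + 1) * ln (real n))) = fps_nth (one_minus_pow \<beta>) n" for n
  proof -
    have "(\<beta> gchoose n) / ((-1) ^ n / e) * inverse e = (-1) ^ n * (\<beta> gchoose n)" if "e > 0" for e
      using that by (cases "even n") simp_all
    thus ?thesis by (simp add: one_minus_pow_nth exp_minus)
  qed
  ultimately show ?thesis by simp
qed

lemma one_minus_pow_nth_nonneg: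
  fixes \<beta> :: real
  assumes "\<beta> \<le> 0"
  shows "fps_nth (one_minus_pow \<beta>) i \<ge> 0"
proof (induction i)
  case (Suc i)
  have "real (Suc i) * fps_nth (one_minus_pow \<beta>) (Suc i) \<ge> 0"
    unfolding one_minus_pow_nth_Suc using Suc assms by (intro mult_nonneg_nonneg) auto
  thus ?case by (simp add: zero_le_mult_iff)
qed simp

text \<open>
  Together with the constant term \<open>1\<close>, this sign pattern is what makes the inverse of
  \<open>one_minus_pow \<alpha> - lam\<close> have nonnegative coefficients when \<open>0 < \<alpha> < 1\<close> and \<open>lam < 0\<close>.
\<close>
lemma one_minus_pow_nth_nonpos:
  fixes \<beta> :: real
  assumes "0 \<le> \<beta>" "\<beta> \<le> 1"
  shows "fps_nth (one_minus_pow \<beta>) (Suc i) \<le> 0"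
proof (induction i)
  case 0
  show ?case using assms by (simp add: one_minus_pow_nth)
next
  case (Suc i)
  have "real (Suc (Suc i)) * fps_nth (one_minus_pow \<beta>) (Suc (Suc i)) \<le> 0"
    unfolding one_minus_pow_nth_Suc using Suc assms by (intro mult_nonneg_nonpos) auto
  thus ?case by (simp add: mult_le_0_iff)
qed

lemma one_minus_pow_sums:
  fixes \<beta> w :: complex
  assumes "norm w < 1"
  shows "(\<lambda>i. fps_nth (one_minus_pow \<beta>) i * w ^ i) sums (1 - w) powr \<beta>"
proof -
  have "(\<lambda>i. (\<beta> gchoose i) * (- w) ^ i) sums (1 + - w) powr \<beta>"
    using assms by (intro gen_binomial_complex) simp
  moreover have "(\<beta> gchoose i) * (- w) ^ i = fps_nth (one_minus_pow \<beta>) i * w ^ i" for i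
    by (simp add: one_minus_pow_nth power_minus[of w])
  ultimately show ?thesis by simp
qed

lemma fps_conv_radius_geI:
  fixes F :: "complex fps"
  assumes "\<And>w. norm w < 1 \<Longrightarrow> summable (\<lambda>i. fps_nth F i * w ^ i)"
  shows "fps_conv_radius F \<ge> 1"
  unfolding fps_conv_radius_def by (rule conv_radius_geI_ex') (auto intro!: assms)

lemma one_minus_pow_conv_radius: "fps_conv_radius (one_minus_pow \<beta> :: complex fps) \<ge> 1"
  by (intro fps_conv_radius_geI sums_summable[OF one_minus_pow_sums])

lemma eval_one_minus_pow:
  "norm (w::complex) < 1 \<Longrightarrow> eval_fps (one_minus_pow \<beta>) w = (1 - w) powr \<beta>"
  using one_minus_pow_sums by (simp add: eval_fps_def sums_iff)

lemma one_minus_pow_has_fps_expansion: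
  "(\<lambda>w::complex. (1 - w) powr \<beta>) has_fps_expansion one_minus_pow \<beta>"
proof -
  have "eventually (\<lambda>w::complex. w \<in> ball 0 1) (nhds 0)"
    by (intro eventually_nhds_in_open) auto
  moreover have "fps_conv_radius (one_minus_pow \<beta> :: complex fps) > 0"
    by (rule less_le_trans[OF _ one_minus_pow_conv_radius]) simp
  ultimately show ?thesis
    by (auto simp: has_fps_expansion_def eval_one_minus_pow elim!: eventually_mono)
qed

section \<open>The reciprocal of \<open>s powr \<beta> - \<Lambda>\<close>\<close>

text \<open>
  Without roots, \<open>s powr \<beta> - \<Lambda>\<close> is bounded away from \<open>0\<close> on the compact closed disc, which includes the
  branch point \<open>s = 0\<close>. The derivative of the reciprocal contains the further factor \<open>s powr (\<beta> - 1)\<close>,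
  which is bounded because \<open>\<beta> > 1\<close>; hence the coefficients of the reciprocal are absolutely summable.
\<close>
lemma resolvent_coeffs_summable:
  fixes \<beta> :: real and \<Lambda> :: complex
  assumes \<beta>: "\<beta> > 1"
    and no_root: "\<And>s. norm (s - 1) \<le> 1 \<Longrightarrow> s powr of_real \<beta> \<noteq> \<Lambda>"
  shows "summable (\<lambda>i. norm (fps_nth (inverse (one_minus_pow (of_real \<beta>) - fps_const \<Lambda>)) i))"
proof -
  \<comment> \<open>The variable is \<open>w = 1 - s\<close>, so that the disc is centred at \<open>0\<close>.\<close>
  define D where "D w = (1 - w) powr of_real \<beta> - \<Lambda>" for w
  define f where "f w = inverse (D w)" for w
  define G where "G = inverse (one_minus_pow (of_real \<beta>) - fps_const \<Lambda>)"
  have Re_pos: "Re (1 - w) > 0" if "norm w < 1" for w :: complex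
    using that complex_Re_le_cmod[of w] by simp
  have D_nz: "D w \<noteq> 0" if "norm w \<le> 1" for w
    using no_root[of "1 - w"] that by (simp add: D_def)
  have cont: "continuous_on (cball 0 1) D"
    unfolding D_def using \<beta>
    by (intro continuous_intros) (auto intro: order.trans[OF complex_Re_le_cmod])
  hence "continuous_on (cball 0 1) f"
    unfolding f_def by (intro continuous_on_inverse) (auto simp: D_nz)
  hence "bounded (f ` cball 0 1)"
    by (intro compact_imp_bounded compact_continuous_image) auto
  then obtain B where "\<forall>y\<in>f ` cball 0 1. norm y \<le> B"
    unfolding bounded_iff by blast
  hence B: "norm (f w) \<le> B" if "norm w \<le> 1" for w using that by simp
  have D_deriv: "(D has_field_derivative (- of_real \<beta> * (1 - w) powr (of_real \<beta> - 1))) (at w)"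
    if "norm w < 1" for w
  proof -
    have "1 - w \<notin> \<real>\<^sub>\<le>\<^sub>0" using Re_pos[OF that] by (auto simp: complex_nonpos_Reals_iff)
    thus ?thesis unfolding D_def by (auto intro!: derivative_eq_intros)
  qed
  have f_deriv: "(f has_field_derivative (of_real \<beta> * (1 - w) powr (of_real \<beta> - 1) * (f w)\<^sup>2)) (at w)"
    if "norm w < 1" for w
  proof -
    have "D w \<noteq> 0" using D_nz[of w] that by simp
    from DERIV_inverse_fun[OF D_deriv[OF that] this] show ?thesis
      by (simp add: f_def[abs_def] power2_eq_square mult_ac)
  qed
  have hol: "f holomorphic_on ball 0 1"
    unfolding holomorphic_on_open[OF open_ball] using f_deriv by fastforce
  have exp: "f has_fps_expansion G"
    unfolding f_def D_def G_def
  proof (intro has_fps_expansion_inverse has_fps_expansion_diff one_minus_pow_has_fps_expansion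
      has_fps_expansion_const)
    show "fps_nth (one_minus_pow (of_real \<beta>) - fps_const \<Lambda>) 0 \<noteq> 0"
      using D_nz[of 0] by (simp add: D_def)
  qed
  have conv: "fps_conv_radius G \<ge> 1"
    using holomorphic_on_imp_fps_conv_radius_ge[OF exp, of 1] hol by (simp add: one_ereal_def)
  have "norm (eval_fps (fps_deriv G) w) \<le> \<beta> * 2 powr (\<beta> - 1) * B\<^sup>2" if w: "norm w < 1" for w
  proof -
    have "eventually (\<lambda>v. v \<in> ball 0 1) (nhds w)"
      using w by (intro eventually_nhds_in_open) auto
    hence "eventually (\<lambda>v. eval_fps G v = f v) (nhds w)"
      by eventually_elim (auto intro!: has_fps_expansion_imp_eval_fps_eq[OF exp _ hol])
    hence "deriv (eval_fps G) w = deriv f w" by (rule deriv_cong_ev) simp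
    moreover have "eval_fps (fps_deriv G) w = deriv (eval_fps G) w"
      using w by (intro eval_fps_deriv less_le_trans[OF _ conv]) simp
    ultimately have eq: "eval_fps (fps_deriv G) w = of_real \<beta> * (1 - w) powr (of_real \<beta> - 1) * (f w)\<^sup>2"
      using DERIV_imp_deriv[OF f_deriv[OF w]] by simp
    have "norm (1 - w) \<le> 2" using w norm_triangle_ineq4[of 1 w] by simp
    hence "norm ((1 - w) powr (of_real (\<beta> - 1))) \<le> 2 powr (\<beta> - 1)"
      using \<beta> by (subst norm_powr_real_powr') (auto intro!: powr_mono2)
    moreover have "(norm (f w))\<^sup>2 \<le> B\<^sup>2" using B[of w] w by (intro power_mono) auto
    ultimately show ?thesis
      unfolding eq norm_mult norm_power using \<beta> by (intro mult_mono) auto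
  qed
  thus ?thesis unfolding G_def [symmetric]
    by (rule bounded_deriv_imp_summable_coeffs[OF conv])
qed

text \<open>
  Responses are real, whereas the roots that decide their fate are complex.
\<close>
definition fps_complex :: "real fps \<Rightarrow> complex fps" where
  "fps_complex F = Abs_fps (\<lambda>i. complex_of_real (fps_nth F i))"

lemma fps_complex_nth [simp]: "fps_nth (fps_complex F) i = of_real (fps_nth F i)"
  by (simp add: fps_complex_def)

lemma fps_complex_diff: "fps_complex (F - G) = fps_complex F - fps_complex G"
  and fps_complex_mult: "fps_complex (F * G) = fps_complex F * fps_complex G"
  and fps_complex_sum: "fps_complex (sum H A) = (\<Sum>x\<in>A. fps_complex (H x))"
  and fps_complex_const: "fps_complex (fps_const c) = fps_const (of_real c)"
  by (rule fps_ext; simp add: fps_mult_nth fps_sum_nth)+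

lemma fps_complex_one_minus_pow: "fps_complex (one_minus_pow \<beta>) = one_minus_pow (of_real \<beta>)"
  by (rule fps_ext) (simp add: one_minus_pow_nth gbinomial_prod_rev)

text \<open>
  Dividing by \<open>s powr \<beta> - \<Lambda>\<close> is convolving with an absolutely summable sequence, which preserves null
  sequences.
\<close>
lemma quotient_coeffs_tendsto_0:
  fixes \<beta> \<Lambda> :: real and Z C :: "real fps"
  assumes "\<beta> > 1"
    and no_root: "\<And>s::complex. norm (s - 1) \<le> 1 \<Longrightarrow> s powr of_real \<beta> \<noteq> of_real \<Lambda>"
    and eq: "(one_minus_pow \<beta> - fps_const \<Lambda>) * Z = C"
    and C: "fps_nth C \<longlonglongrightarrow> 0"
  shows "fps_nth Z \<longlonglongrightarrow> 0"
proof -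
  define D where "D = one_minus_pow (of_real \<beta>) - fps_const (complex_of_real \<Lambda>)"
  have "fps_nth D 0 \<noteq> 0" using no_root[of 1] by (simp add: D_def)
  hence "inverse D * D = 1" by (rule inverse_mult_eq_1)
  moreover have "D * fps_complex Z = fps_complex C"
    unfolding D_def eq [symmetric]
    by (simp only: fps_complex_mult fps_complex_diff fps_complex_const fps_complex_one_minus_pow)
  ultimately have Z: "fps_complex Z = inverse D * fps_complex C"
    by (metis mult.assoc mult_1)
  have "of_real (fps_nth Z n) = (\<Sum>j=0..n. fps_nth (inverse D) j * of_real (fps_nth C (n - j)))" for n
  proof -
    have "fps_nth (fps_complex Z) n = fps_nth (inverse D * fps_complex C) n" by (simp only: Z)
    thus ?thesis by (simp only: fps_mult_nth fps_complex_nth)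
  qed
  moreover have "(\<lambda>n. complex_of_real (fps_nth C n)) \<longlonglongrightarrow> 0"
    using tendsto_of_real[OF C, where 'a=complex] by simp
  hence "(\<lambda>n. \<Sum>j=0..n. fps_nth (inverse D) j * of_real (fps_nth C (n - j))) \<longlonglongrightarrow> 0"
    unfolding D_def by (intro convolution_tendsto_0 resolvent_coeffs_summable no_root \<open>\<beta> > 1\<close>)
  ultimately have "(\<lambda>n. complex_of_real (fps_nth Z n)) \<longlonglongrightarrow> of_real 0" by simp
  thus ?thesis by (simp only: tendsto_of_real_iff)
qed

section \<open>The generating function of a response\<close>

definition nabla_gf :: "nat \<Rightarrow> (real \<Rightarrow> real) \<Rightarrow> real \<Rightarrow> real fps" where
  "nabla_gf n y a = Abs_fps (\<lambda>i. nabla n y (a + 1 + real i))"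

lemma nabla_gf_nth [simp]: "fps_nth (nabla_gf n y a) i = nabla n y (a + 1 + real i)"
  by (simp add: nabla_gf_def)

lemma nabla_0 [simp]: "nabla 0 f k = f k"
  by (simp add: nabla_def)

lemma nabla_gf_seq: "fps_nth (nabla_gf 0 y a) = (\<lambda>i. y (a + 1 + real i))"
  by (rule ext) simp

text \<open>
  Pascal's rule.
\<close>
lemma nabla_Suc: "nabla (Suc n) f k = nabla n f k - nabla n f (k - 1)"
proof -
  define t where "t j = (-1) ^ j * real (n choose j) * f (k - real j)" for j
  define u where "u j = (-1) ^ j * real (n choose j) * f (k - 1 - real j)" for j
  have "nabla n f k = (\<Sum>j=0..Suc n. t j)"
    by (simp add: nabla_def t_def)
  also have "\<dots> = f k + (\<Sum>j=0..n. t (Suc j))"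
    by (subst sum.atLeast0_atMost_Suc_shift) (simp add: t_def)
  finally have 1: "nabla n f k = f k + (\<Sum>j=0..n. t (Suc j))" .
  have 2: "nabla n f (k - 1) = (\<Sum>j=0..n. u j)"
    by (simp add: nabla_def u_def)
  have "nabla (Suc n) f k = f k + (\<Sum>j=0..n. (-1) ^ Suc j * real (Suc n choose Suc j) * f (k - real (Suc j)))"
    unfolding nabla_def by (subst sum.atLeast0_atMost_Suc_shift) simp
  also have "(\<Sum>j=0..n. (-1) ^ Suc j * real (Suc n choose Suc j) * f (k - real (Suc j))) =
      (\<Sum>j=0..n. t (Suc j) - u j)"
    by (intro sum.cong refl) (simp add: t_def u_def algebra_simps)
  finally show ?thesis by (simp add: 1 2 sum_subtractf)
qed

text \<open>
  Delaying a sequence by one step multiplies its generating function by \<open>w\<close> and brings in the value at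
  \<open>a\<close>; thus a backward difference is multiplication by \<open>1 - w\<close>, up to the initial value.
\<close>
lemma nabla_gf_Suc:
  "nabla_gf (Suc n) y a = one_minus_pow 1 * nabla_gf n y a - fps_const (nabla n y a)"
proof (rule fps_ext)
  fix i
  show "fps_nth (nabla_gf (Suc n) y a) i =
      fps_nth (one_minus_pow 1 * nabla_gf n y a - fps_const (nabla n y a)) i"
    by (cases i) (simp_all add: one_minus_pow_1 nabla_Suc left_diff_distrib add_ac)
qed

lemma nabla_gf_expand:
  "nabla_gf n y a = one_minus_pow (real n) * nabla_gf 0 y a -
     (\<Sum>\<kappa><n. fps_const (nabla \<kappa> y a) * one_minus_pow (real n - 1 - real \<kappa>))"
proof (induction n)
  case (Suc n)
  have "one_minus_pow 1 * one_minus_pow (real n - 1 - real \<kappa>) =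
      one_minus_pow (real (Suc n) - 1 - real \<kappa>)" for \<kappa>
    by (simp flip: one_minus_pow_add)
  hence *: "one_minus_pow 1 * (fps_const (nabla \<kappa> y a) * one_minus_pow (real n - 1 - real \<kappa>)) =
      fps_const (nabla \<kappa> y a) * one_minus_pow (real (Suc n) - 1 - real \<kappa>)" for \<kappa>
    by (metis mult.left_commute)
  have "one_minus_pow (real (Suc n)) = one_minus_pow 1 * one_minus_pow (real n)"
    by (simp flip: one_minus_pow_add)
  thus ?case
    unfolding nabla_gf_Suc Suc.IH right_diff_distrib sum_distrib_left *
    by (simp add: mult.assoc)
qed simp

lemma nabla_caputo_gf:
  "nabla_caputo n \<alpha> a y (a + 1 + real i) =
     fps_nth (one_minus_pow (\<alpha> - real n) * nabla_gf n y a) i"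
proof -
  have "nabla n y (a + 1 + real i - real j) = fps_nth (nabla_gf n y a) (i - j)" if "j \<le> i" for j
    using that by (simp add: of_nat_diff algebra_simps)
  thus ?thesis
    unfolding nabla_caputo_def nabla_fsum_def fps_mult_nth
    by (intro sum.cong) (simp_all add: one_minus_pow_nth)
qed

text \<open>
  With \<open>s = 1 - w\<close>, the difference of order \<open>n\<close> contributes the factor \<open>s ^ n\<close> and the fractional sum of
  order \<open>n - \<alpha>\<close> the factor \<open>s powr (\<alpha> - n)\<close>, so the system becomes
  \<open>(s powr \<alpha> - lam) * Y = (\<Sum>\<kappa><n. b \<kappa> * s powr (\<alpha> - 1 - \<kappa>))\<close>. The equivalence serves both to analyse a
  given response and to construct one.
\<close>
lemma is_response_iff_gf:
  "is_response n \<alpha> a lam b y \<longleftrightarrow> (\<forall>\<kappa><n. nabla \<kappa> y a = b \<kappa>) \<and>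
     (one_minus_pow \<alpha> - fps_const lam) * nabla_gf 0 y a =
       (\<Sum>\<kappa><n. fps_const (b \<kappa>) * one_minus_pow (\<alpha> - 1 - real \<kappa>))"
proof (cases "\<forall>\<kappa><n. nabla \<kappa> y a = b \<kappa>")
  case True
  have *: "one_minus_pow (\<alpha> - real n) * (fps_const (b \<kappa>) * one_minus_pow (real n - 1 - real \<kappa>)) =
      fps_const (b \<kappa>) * one_minus_pow (\<alpha> - 1 - real \<kappa>)" for \<kappa>
  proof -
    have "one_minus_pow (\<alpha> - real n) * one_minus_pow (real n - 1 - real \<kappa>) =
        one_minus_pow (\<alpha> - 1 - real \<kappa>)"
      by (simp add: algebra_simps flip: one_minus_pow_add)
    thus ?thesis by (metis mult.left_commute)
  qed
  have "(\<forall>k\<in>Nfrom (a + 1). nabla_caputo n \<alpha> a y k = lam * y k) \<longleftrightarrow>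
      one_minus_pow (\<alpha> - real n) * nabla_gf n y a = fps_const lam * nabla_gf 0 y a"
    by (auto simp: Nfrom_def fps_eq_iff nabla_caputo_gf)
  also have "one_minus_pow (\<alpha> - real n) * nabla_gf n y a =
      one_minus_pow \<alpha> * nabla_gf 0 y a -
        (\<Sum>\<kappa><n. fps_const (b \<kappa>) * one_minus_pow (\<alpha> - 1 - real \<kappa>))"
  proof -
    have "nabla_gf n y a = one_minus_pow (real n) * nabla_gf 0 y a -
       (\<Sum>\<kappa><n. fps_const (b \<kappa>) * one_minus_pow (real n - 1 - real \<kappa>))"
      by (subst nabla_gf_expand) (use True in simp)
    moreover have "one_minus_pow (\<alpha> - real n) * one_minus_pow (real n) = one_minus_pow \<alpha>"
      by (simp flip: one_minus_pow_add)
    ultimately show ?thesis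
      by (simp only: right_diff_distrib sum_distrib_left *) (simp only: mult.assoc [symmetric])
  qed
  finally have "(\<forall>k\<in>Nfrom (a + 1). nabla_caputo n \<alpha> a y k = lam * y k) \<longleftrightarrow>
      (one_minus_pow \<alpha> - fps_const lam) * nabla_gf 0 y a =
        (\<Sum>\<kappa><n. fps_const (b \<kappa>) * one_minus_pow (\<alpha> - 1 - real \<kappa>))"
    unfolding left_diff_distrib diff_eq_eq add.commute[of "fps_const lam * _"] by (simp only:)
  thus ?thesis unfolding is_response_def using True by blast
next
  case False
  thus ?thesis unfolding is_response_def by blast
qed

text \<open>
  The most singular summand has exponent \<open>\<beta> - n > -1\<close>.
\<close>
lemma forcing_coeffs_tendsto_0:
  fixes b :: "nat \<Rightarrow> real"
  assumes "\<beta> > real n - 1"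
  shows "fps_nth (\<Sum>\<kappa><n. fps_const (b \<kappa>) * one_minus_pow (\<beta> - 1 - real \<kappa>)) \<longlonglongrightarrow> 0"
proof -
  have "(\<lambda>i. \<Sum>\<kappa><n. b \<kappa> * fps_nth (one_minus_pow (\<beta> - 1 - real \<kappa>)) i) \<longlonglongrightarrow> (\<Sum>\<kappa><n. b \<kappa> * 0)"
    using assms by (intro tendsto_sum tendsto_mult tendsto_const one_minus_pow_tendsto_0) auto
  moreover have "fps_nth (\<Sum>\<kappa><n. fps_const (b \<kappa>) * one_minus_pow (\<beta> - 1 - real \<kappa>)) =
      (\<lambda>i. \<Sum>\<kappa><n. b \<kappa> * fps_nth (one_minus_pow (\<beta> - 1 - real \<kappa>)) i)"
    by (rule ext) (simp add: fps_sum_nth)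
  ultimately show ?thesis by simp
qed

section \<open>Divergence from an excited mode\<close>

text \<open>
  The generating function of a convergent, hence bounded, sequence converges in the open unit disc.
  Evaluating the equation at \<open>w = 1 - s\<close> annihilates its left-hand side, while the right-hand side is
  \<open>s powr (\<alpha> - 1)\<close> times the amplitude.
\<close>
lemma excited_mode_imp_divergent:
  fixes s :: complex
  assumes resp: "is_response n \<alpha> a lam b y"
    and s: "norm (s - 1) < 1" "s powr of_real \<alpha> = of_real lam"
    and amp: "mode_amplitude n b s \<noteq> 0"
  shows "divergent_from (a + 1) y"
proof (rule ccontr)
  assume "\<not> divergent_from (a + 1) y"
  hence "convergent (\<lambda>i. y (a + 1 + real i))"
    by (simp add: divergent_from_def convergent_from_def tends_to_from_def convergent_def)
  then obtain B where "\<And>i. norm (y (a + 1 + real i)) \<le> B"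
    using convergent_imp_Bseq BseqE by metis
  hence B: "\<bar>y (a + 1 + real i)\<bar> \<le> B" for i by simp
  define w where "w = 1 - s"
  have w: "norm w < 1" using s by (simp add: w_def norm_minus_commute)
  have ws: "1 - w = s" by (simp add: w_def)
  have s0: "s \<noteq> 0" using s by auto
  define Z where "Z = fps_complex (nabla_gf 0 y a)"
  define D where "D = one_minus_pow (of_real \<alpha>) - fps_const (complex_of_real lam)"
  define N where "N = (\<Sum>\<kappa><n. fps_const (of_real (b \<kappa>)) * one_minus_pow (complex_of_real (\<alpha> - 1 - real \<kappa>)))"
  have "fps_complex ((one_minus_pow \<alpha> - fps_const lam) * nabla_gf 0 y a) =
      fps_complex (\<Sum>\<kappa><n. fps_const (b \<kappa>) * one_minus_pow (\<alpha> - 1 - real \<kappa>))"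
    using resp by (simp only: is_response_iff_gf)
  hence eq: "D * Z = N"
    by (simp only: fps_complex_mult fps_complex_diff fps_complex_sum fps_complex_const
        fps_complex_one_minus_pow D_def Z_def N_def)
  have Z_conv: "fps_conv_radius Z \<ge> 1"
  proof (rule fps_conv_radius_geI)
    fix v :: complex assume v: "norm v < 1"
    have "summable (\<lambda>i. B * norm v ^ i)" using v by (intro summable_mult summable_geometric) simp
    thus "summable (\<lambda>i. fps_nth Z i * v ^ i)"
      by (rule summable_comparison_test') (auto simp: Z_def norm_mult norm_power intro!: mult_right_mono B)
  qed
  have D_conv: "fps_conv_radius D \<ge> 1"
    unfolding D_def using one_minus_pow_conv_radius[of "of_real \<alpha>"]
    by (intro order.trans[OF _ fps_conv_radius_diff]) simp
  have w': "ereal (norm w) < fps_conv_radius F" if "fps_conv_radius F \<ge> 1" for F :: "complex fps"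
    using w by (intro less_le_trans[OF _ that]) simp
  have "eval_fps D w = (1 - w) powr of_real \<alpha> - of_real lam"
    unfolding D_def using w
    by (subst eval_fps_diff) (simp_all add: eval_one_minus_pow w' one_minus_pow_conv_radius)
  hence "eval_fps D w = 0" using s by (simp add: ws)
  hence "eval_fps N w = 0"
    unfolding eq [symmetric] by (simp add: eval_fps_mult w' Z_conv D_conv)
  moreover have "(\<lambda>i. \<Sum>\<kappa><n. of_real (b \<kappa>) *
        (fps_nth (one_minus_pow (complex_of_real (\<alpha> - 1 - real \<kappa>))) i * w ^ i)) sums
      (\<Sum>\<kappa><n. of_real (b \<kappa>) * (1 - w) powr of_real (\<alpha> - 1 - real \<kappa>))"
    by (intro sums_sum sums_mult one_minus_pow_sums w)
  hence "eval_fps N w = (\<Sum>\<kappa><n. of_real (b \<kappa>) * s powr of_real (\<alpha> - 1 - real \<kappa>))"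
    unfolding eval_fps_def N_def ws
    by (simp add: sums_iff fps_sum_nth sum_distrib_right mult.assoc)
  moreover have "s powr of_real (\<alpha> - 1 - real \<kappa>) = s powr of_real (\<alpha> - 1) / s ^ \<kappa>" for \<kappa>
    using s0 by (simp add: powr_diff powr_nat)
  ultimately have "s powr of_real (\<alpha> - 1) * mode_amplitude n b s = 0"
    by (simp add: mode_amplitude_def sum_distrib_left mult_ac)
  thus False using s0 amp by simp
qed

lemma principal_root_powr:
  assumes "lam \<noteq> 0" "\<alpha> > 0" "lam < 0 \<Longrightarrow> \<alpha> \<ge> 1"
  shows "principal_root \<alpha> lam powr of_real \<alpha> = of_real lam"
proof -
  define \<theta> where "\<theta> = (if lam < 0 then pi / \<alpha> else 0)"
  define r where "r = \<bar>lam\<bar> powr (1 / \<alpha>)"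
  have r: "r > 0" using assms by (simp add: r_def)
  have \<theta>: "0 \<le> \<theta>" "\<theta> \<le> pi" using assms by (auto simp: \<theta>_def field_simps)
  have root: "principal_root \<alpha> lam = of_real r * exp (\<i> * of_real \<theta>)"
    by (simp add: principal_root_def r_def \<theta>_def cis_conv_exp)
  have nz: "principal_root \<alpha> lam \<noteq> 0" using r by (simp add: root)
  have "Ln (principal_root \<alpha> lam) = of_real (ln r) + \<i> * of_real \<theta>"
  proof (rule Ln_unique)
    show "exp (of_real (ln r) + \<i> * of_real \<theta>) = principal_root \<alpha> lam"
      using r by (simp only: root exp_add exp_of_real exp_ln)
    show "- pi < Im (of_real (ln r) + \<i> * of_real \<theta>)"
      using \<theta> pi_gt_zero by (simp, linarith)
  qed (use \<theta> in simp)
  hence "principal_root \<alpha> lam powr of_real \<alpha> = exp (of_real (\<alpha> * ln r) + \<i> * of_real (\<alpha> * \<theta>))"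
    using nz by (simp add: powr_def algebra_simps)
  also have "\<dots> = of_real (r powr \<alpha>) * cis (\<alpha> * \<theta>)"
    using r by (simp add: exp_add powr_def cis_conv_exp flip: exp_of_real)
  also have "r powr \<alpha> = \<bar>lam\<bar>" using assms by (simp add: r_def powr_powr)
  also have "of_real \<bar>lam\<bar> * cis (\<alpha> * \<theta>) = of_real lam"
    using assms by (auto simp: \<theta>_def)
  finally show ?thesis .
qed

lemma pos_root_in_disc:
  assumes "0 < lam" "lam < 2 powr \<alpha>" "\<alpha> > 0"
  shows "norm (principal_root \<alpha> lam - 1) < 1"
proof -
  have "lam powr (1 / \<alpha>) < (2 powr \<alpha>) powr (1 / \<alpha>)"
    using assms by (intro powr_less_mono2) auto
  hence "lam powr (1 / \<alpha>) < 2" using assms by (simp add: powr_powr)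
  moreover have "lam powr (1 / \<alpha>) > 0" using assms by simp
  moreover have "principal_root \<alpha> lam - 1 = of_real (lam powr (1 / \<alpha>) - 1)"
    using assms by (simp add: principal_root_def)
  ultimately show ?thesis by (simp only: norm_of_real)
qed

text \<open>
  In polar form the open disc \<open>norm (s - 1) < 1\<close> is \<open>0 < norm s < 2 * cos (Arg s)\<close>, and the principal
  root has argument \<open>pi / \<alpha>\<close>.
\<close>
lemma neg_root_in_disc:
  assumes "lam < 0" "\<alpha> > 2" "\<bar>lam\<bar> < 2 powr \<alpha> * cos (pi / \<alpha>) powr \<alpha>"
  shows "norm (principal_root \<alpha> lam - 1) < 1"
proof -
  define r where "r = \<bar>lam\<bar> powr (1 / \<alpha>)"
  define c where "c = cos (pi / \<alpha>)"
  have "pi / \<alpha> < pi / 2" using assms by (intro divide_strict_left_mono) auto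
  hence c: "c > 0" unfolding c_def using assms by (intro cos_gt_zero) auto
  have "r < ((2 * c) powr \<alpha>) powr (1 / \<alpha>)"
    unfolding r_def using assms c by (intro powr_less_mono2) (auto simp: powr_mult c_def)
  hence r: "r < 2 * c" using assms c by (simp add: powr_powr)
  have r0: "r > 0" using assms by (simp add: r_def)
  have "(norm (principal_root \<alpha> lam - 1))\<^sup>2 = (r * c - 1)\<^sup>2 + (r * sin (pi / \<alpha>))\<^sup>2"
    using assms by (simp add: cmod_power2 principal_root_def r_def c_def)
  also have "\<dots> = r\<^sup>2 * (c\<^sup>2 + (sin (pi / \<alpha>))\<^sup>2) - 2 * r * c + 1"
    by (simp add: power2_eq_square algebra_simps)
  also have "\<dots> = 1 - r * (2 * c - r)"
    by (simp add: c_def power2_eq_square algebra_simps)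
  also have "\<dots> < 1\<^sup>2" using r r0 by simp
  finally show ?thesis by (rule power2_less_imp_less) simp
qed

section \<open>Decay when the closed disc contains no root\<close>

lemma closed_disc_norm_le:
  fixes s :: complex
  assumes "norm (s - 1) \<le> 1"
  shows "norm s \<le> 2" and "(norm s)\<^sup>2 \<le> 2 * Re s"
proof -
  show "norm s \<le> 2" using assms norm_triangle_ineq[of "s - 1" 1] by simp
  have "(norm (s - 1))\<^sup>2 \<le> 1\<^sup>2" using assms by (intro power_mono) auto
  thus "(norm s)\<^sup>2 \<le> 2 * Re s" unfolding cmod_power2 by (simp add: power2_eq_square algebra_simps)
qed

text \<open>
  A root \<open>s\<close> of argument \<open>\<theta>\<close> needs \<open>\<alpha> * \<theta>\<close> to be an odd multiple of \<open>pi\<close>, hence \<open>\<bar>\<theta>\<bar> \<ge> pi / \<alpha>\<close>. In the closed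
  disc \<open>\<bar>\<theta>\<bar> < pi / 2\<close> and \<open>norm s \<le> 2 * cos \<theta>\<close>. These are incompatible for \<open>\<alpha> \<le> 2\<close>, and for \<open>\<alpha> > 2\<close> they
  bound \<open>\<bar>lam\<bar> = norm s powr \<alpha>\<close> by \<open>(2 * cos (pi / \<alpha>)) powr \<alpha>\<close>.
\<close>
lemma neg_no_root_in_closed_disc:
  fixes s :: complex
  assumes "\<alpha> > 1" "lam < 0"
    and large: "\<alpha> > 2 \<Longrightarrow> \<bar>lam\<bar> > 2 powr \<alpha> * cos (pi / \<alpha>) powr \<alpha>"
    and s: "norm (s - 1) \<le> 1"
  shows "s powr of_real \<alpha> \<noteq> of_real lam"
proof
  assume eq: "s powr of_real \<alpha> = of_real lam"
  define \<theta> where "\<theta> = Arg s"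
  have s0: "s \<noteq> 0" using eq assms by auto
  have Re: "Re s > 0"
  proof -
    have "(norm s)\<^sup>2 > 0" using s0 by simp
    thus ?thesis using closed_disc_norm_le(2)[OF s] by linarith
  qed
  hence \<theta>: "\<bar>\<theta>\<bar> < pi / 2" using Arg_Re_pos[of s] by (simp only: \<theta>_def) blast
  have "s = of_real (norm s) * exp (\<i> * of_real \<theta>)" using s0 by (simp add: \<theta>_def Arg_eq)
  hence "Re s = Re (of_real (norm s) * exp (\<i> * of_real \<theta>))" by simp
  hence "Re s = norm s * cos \<theta>" by (simp add: Re_exp)
  hence "norm s * norm s \<le> norm s * (2 * cos \<theta>)"
    using closed_disc_norm_le(2)[OF s] by (simp add: power2_eq_square)
  hence norm_le: "norm s \<le> 2 * cos \<theta>" using s0 by simp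
  have "s powr of_real \<alpha> = exp (of_real (\<alpha> * ln (norm s)) + \<i> * of_real (\<alpha> * \<theta>))"
    using s0 by (simp add: powr_def Ln_Arg \<theta>_def algebra_simps)
  hence pol: "of_real lam = of_real (norm s powr \<alpha>) * cis (\<alpha> * \<theta>)"
    using s0 eq by (simp add: exp_add powr_def cis_conv_exp flip: exp_of_real)
  have p: "norm s powr \<alpha> > 0" using s0 by simp
  have re: "lam = norm s powr \<alpha> * cos (\<alpha> * \<theta>)" using arg_cong[OF pol, of Re] by simp
  have im: "sin (\<alpha> * \<theta>) = 0" using arg_cong[OF pol, of Im] p by simp
  have lam_abs: "\<bar>lam\<bar> = norm s powr \<alpha>"
    using arg_cong[OF pol, of norm] by (simp add: norm_mult)
  show False
  proof (cases "\<bar>\<theta>\<bar> < pi / \<alpha>")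
    case True
    hence "\<bar>\<alpha> * \<theta>\<bar> < pi" using assms by (simp add: abs_mult field_simps)
    hence "- pi < \<alpha> * \<theta>" "\<alpha> * \<theta> < pi" by linarith+
    from sin_eq_0_pi[OF this im] have "\<alpha> * \<theta> = 0" .
    thus False using re p assms by simp
  next
    case False
    hence "pi / \<alpha> < pi / 2" using \<theta> by linarith
    hence "\<alpha> > 2" using assms by (simp add: field_simps)
    have "cos \<theta> = cos \<bar>\<theta>\<bar>" by simp
    also have "\<dots> \<le> cos (pi / \<alpha>)"
      using False \<theta> assms by (subst cos_mono_le_eq) auto
    finally have "norm s \<le> 2 * cos (pi / \<alpha>)" using norm_le by simp
    hence "norm s powr \<alpha> \<le> (2 * cos (pi / \<alpha>)) powr \<alpha>"
      using assms by (intro powr_mono2) auto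
    also have "\<dots> = 2 powr \<alpha> * cos (pi / \<alpha>) powr \<alpha>"
      by (simp add: powr_mult)
    finally show False using large[OF \<open>\<alpha> > 2\<close>] lam_abs by simp
  qed
qed

lemma neg_response_tendsto_0:
  assumes resp: "is_response n \<alpha> a lam b y" and \<alpha>: "real n - 1 < \<alpha>" "\<alpha> > 1" and "lam < 0"
    and large: "\<alpha> > 2 \<Longrightarrow> \<bar>lam\<bar> > 2 powr \<alpha> * cos (pi / \<alpha>) powr \<alpha>"
  shows "tends_to_from (a + 1) y 0"
proof -
  have "fps_nth (nabla_gf 0 y a) \<longlonglongrightarrow> 0"
  proof (rule quotient_coeffs_tendsto_0[where \<beta> = \<alpha> and \<Lambda> = lam])
    show "(one_minus_pow \<alpha> - fps_const lam) * nabla_gf 0 y a =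
       (\<Sum>\<kappa><n. fps_const (b \<kappa>) * one_minus_pow (\<alpha> - 1 - real \<kappa>))"
      using resp by (simp only: is_response_iff_gf)
    show "fps_nth (\<Sum>\<kappa><n. fps_const (b \<kappa>) * one_minus_pow (\<alpha> - 1 - real \<kappa>)) \<longlonglongrightarrow> 0"
      by (rule forcing_coeffs_tendsto_0) fact
    show "s powr of_real \<alpha> \<noteq> of_real lam" if "norm (s - 1) \<le> 1" for s :: complex
      by (rule neg_no_root_in_closed_disc[OF \<open>\<alpha> > 1\<close> \<open>lam < 0\<close> large that])
  qed fact
  thus ?thesis by (simp only: tends_to_from_def nabla_gf_seq)
qed

text \<open>
  The exponent \<open>\<alpha>\<close> may be below \<open>1\<close>, where the derivative of the reciprocal of \<open>s powr \<alpha> - lam\<close> is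
  unbounded. Multiplying the equation by
  \<open>(\<Sum>i<q. lam ^ (q - 1 - i) * s powr (i * \<alpha>))\<close> replaces \<open>\<alpha>\<close> by \<open>q * \<alpha> > 1\<close> and \<open>lam\<close> by \<open>lam ^ q\<close>; no roots
  are added to the closed disc, because \<open>norm s \<le> 2\<close> there and \<open>lam > 2 powr \<alpha>\<close>.
\<close>
lemma pos_response_tendsto_0:
  assumes resp: "is_response n \<alpha> a lam b y" and \<alpha>: "real n - 1 < \<alpha>" "\<alpha> > 0"
    and large: "lam > 2 powr \<alpha>"
  shows "tends_to_from (a + 1) y 0"
proof -
  obtain q :: nat where q: "real q * \<alpha> > 1" 
    using reals_Archimedean3[OF \<alpha>(2), THEN spec, of 1] by (elim exE)
  have "0 < (2::real) powr \<alpha>" by simp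
  hence lam: "lam > 0" using large by (rule less_trans)
  define N where "N = (\<Sum>\<kappa><n. fps_const (b \<kappa>) * one_minus_pow (\<alpha> - 1 - real \<kappa>))"
  define C where "C = (\<Sum>i<q. fps_const (lam ^ (q - Suc i)) * (one_minus_pow (real i * \<alpha>) * N))"
  have q0: "q \<noteq> 0" using q by (cases q) auto
  have "fps_nth (nabla_gf 0 y a) \<longlonglongrightarrow> 0"
  proof (rule quotient_coeffs_tendsto_0[OF q])
    show "s powr of_real (real q * \<alpha>) \<noteq> of_real (lam ^ q)" if "norm (s - 1) \<le> 1" for s :: complex
    proof
      assume eq: "s powr of_real (real q * \<alpha>) = of_real (lam ^ q)"
      have "lam ^ q = norm (s powr of_real (real q * \<alpha>))" unfolding eq norm_of_real using lam by simp
      also have "\<dots> = norm s powr (real q * \<alpha>)" 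
        by (subst norm_powr_real_powr') (auto simp del: of_real_mult)
      also have "\<dots> \<le> 2 powr (real q * \<alpha>)"
        using closed_disc_norm_le(1)[OF that] q by (intro powr_mono2) auto
      also have "\<dots> = (2 powr \<alpha>) ^ q"
        by (simp add: powr_realpow [symmetric] powr_powr mult.commute)
      also have "\<dots> < lam ^ q" using large q0 by (intro power_strict_mono) auto
      finally show False by simp
    qed
    have "(one_minus_pow (real q * \<alpha>) - fps_const (lam ^ q)) * nabla_gf 0 y a =
        (one_minus_pow \<alpha> ^ q - fps_const lam ^ q) * nabla_gf 0 y a"
      by (simp add: one_minus_pow_power fps_const_power)
    also have "\<dots> = (\<Sum>i<q. fps_const lam ^ (q - Suc i) * one_minus_pow \<alpha> ^ i) *
        ((one_minus_pow \<alpha> - fps_const lam) * nabla_gf 0 y a)"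
      by (simp only: power_diff_sumr2 mult_ac)
    also have "(one_minus_pow \<alpha> - fps_const lam) * nabla_gf 0 y a = N"
      unfolding N_def using resp by (simp only: is_response_iff_gf)
    finally show "(one_minus_pow (real q * \<alpha>) - fps_const (lam ^ q)) * nabla_gf 0 y a = C"
      by (simp only: C_def sum_distrib_right fps_const_power one_minus_pow_power mult.assoc)
    have "fps_nth (one_minus_pow (real i * \<alpha>) * N) \<longlonglongrightarrow> 0" for i
    proof -
      have "one_minus_pow (real i * \<alpha>) * N =
          (\<Sum>\<kappa><n. fps_const (b \<kappa>) * one_minus_pow ((real i * \<alpha> + \<alpha>) - 1 - real \<kappa>))"
        by (simp add: N_def sum_distrib_left mult.left_commute add_diff_eq flip: one_minus_pow_add)
      thus ?thesis using \<alpha> by (simp only:) (intro forcing_coeffs_tendsto_0, simp add: add_strict_increasing2)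
    qed
    hence "(\<lambda>k. \<Sum>i<q. lam ^ (q - Suc i) * fps_nth (one_minus_pow (real i * \<alpha>) * N) k) \<longlonglongrightarrow>
        (\<Sum>i<q. lam ^ (q - Suc i) * 0)"
      by (intro tendsto_sum tendsto_mult tendsto_const)
    moreover have "fps_nth C = (\<lambda>k. \<Sum>i<q. lam ^ (q - Suc i) * fps_nth (one_minus_pow (real i * \<alpha>) * N) k)"
      by (rule ext) (simp add: C_def fps_sum_nth)
    ultimately show "fps_nth C \<longlonglongrightarrow> 0" by simp
  qed
  thus ?thesis by (simp only: tends_to_from_def nabla_gf_seq)
qed

section \<open>Order below one and negative parameter\<close>

text \<open>
  Solving \<open>P * inverse P = 1\<close> for the last coefficient expresses it as a nonnegative combination of the
  preceding ones.
\<close>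
lemma inverse_nonneg_coeffs:
  fixes P :: "real fps"
  assumes P0: "fps_nth P 0 > 0" and P: "\<And>i. fps_nth P (Suc i) \<le> 0"
  shows "fps_nth (inverse P) i \<ge> 0"
proof (induction i rule: less_induct)
  case (less i)
  have PR: "P * inverse P = 1" using P0 by (subst mult.commute) (intro inverse_mult_eq_1, simp)
  show ?case
  proof (cases i)
    case 0
    thus ?thesis using P0 by simp
  next
    case (Suc m)
    have "0 = fps_nth (P * inverse P) (Suc m)" by (simp add: PR)
    also have "\<dots> = fps_nth P 0 * fps_nth (inverse P) (Suc m) +
        (\<Sum>j=0..m. fps_nth P (Suc j) * fps_nth (inverse P) (m - j))"
      unfolding fps_mult_nth by (subst sum.atLeast0_atMost_Suc_shift) simp
    finally have "fps_nth P 0 * fps_nth (inverse P) (Suc m) =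
        - (\<Sum>j=0..m. fps_nth P (Suc j) * fps_nth (inverse P) (m - j))" by linarith
    moreover have "(\<Sum>j=0..m. fps_nth P (Suc j) * fps_nth (inverse P) (m - j)) \<le> 0"
      using P less Suc by (intro sum_nonpos mult_nonpos_nonneg) auto
    ultimately have "fps_nth P 0 * fps_nth (inverse P) i \<ge> 0" using Suc by simp
    thus ?thesis using P0 by (simp add: zero_le_mult_iff)
  qed
qed

lemma fps_mult_nth_nonneg:
  fixes F G :: "real fps"
  assumes "\<And>i. fps_nth F i \<ge> 0" "\<And>i. fps_nth G i \<ge> 0"
  shows "fps_nth (F * G) i \<ge> 0"
  unfolding fps_mult_nth by (intro sum_nonneg mult_nonneg_nonneg assms)

text \<open>
  Up to the factor \<open>b 0\<close>, the generating function is \<open>H = s powr (\<alpha> - 1) / (s powr \<alpha> - lam)\<close>, a product of two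
  series with nonnegative coefficients. Moreover \<open>s * H = 1 + lam / (s powr \<alpha> - lam)\<close>, so that all
  differences of the coefficients of \<open>H\<close> are nonpositive: they decrease and are bounded below by \<open>0\<close>.
\<close>
lemma order_below_one_monotone_convergent:
  assumes resp: "is_response 1 \<alpha> a lam b y" and \<alpha>: "0 < \<alpha>" "\<alpha> < 1" and lam: "lam < 0"
  shows "monotone_from (a + 1) y \<and> convergent_from (a + 1) y"
proof -
  define P where "P = one_minus_pow \<alpha> - fps_const lam"
  define R where "R = inverse P"
  define H where "H = R * one_minus_pow (\<alpha> - 1)"
  have P0: "fps_nth P 0 > 0" using lam by (simp add: P_def)
  have RP: "R * P = 1" unfolding R_def by (rule inverse_mult_eq_1) (use P0 in simp)
  have R_nonneg: "fps_nth R i \<ge> 0" for i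
    unfolding R_def
  proof (rule inverse_nonneg_coeffs[OF P0])
    show "fps_nth P (Suc i) \<le> 0" for i
      using one_minus_pow_nth_nonpos[of \<alpha> i] \<alpha> by (simp add: P_def)
  qed
  have H_nonneg: "fps_nth H i \<ge> 0" for i
    unfolding H_def using \<alpha> by (intro fps_mult_nth_nonneg R_nonneg one_minus_pow_nth_nonneg) simp
  have "P * nabla_gf 0 y a = fps_const (b 0) * one_minus_pow (\<alpha> - 1)"
    using resp unfolding is_response_iff_gf P_def by simp
  hence "R * P * nabla_gf 0 y a = fps_const (b 0) * H"
    by (simp add: H_def mult_ac)
  hence y: "y (a + 1 + real i) = b 0 * fps_nth H i" for i
    using RP nabla_gf_seq[of y a] by (metis fps_mult_left_const_nth mult_1)
  have "one_minus_pow (\<alpha> - 1) * one_minus_pow 1 = P + fps_const lam"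
    by (simp add: P_def flip: one_minus_pow_add)
  hence "H * (1 - fps_X) = 1 + fps_const lam * R"
  proof -
    have "H * (1 - fps_X) = R * (one_minus_pow (\<alpha> - 1) * one_minus_pow 1)"
      by (simp only: H_def one_minus_pow_1 mult.assoc)
    also have "\<dots> = R * P + R * fps_const lam"
      by (simp only: \<open>one_minus_pow (\<alpha> - 1) * one_minus_pow 1 = P + fps_const lam\<close> distrib_left)
    also have "\<dots> = 1 + fps_const lam * R" unfolding RP by (simp only: mult.commute)
    finally show ?thesis .
  qed
  hence "fps_nth (H * (1 - fps_X)) (Suc i) = fps_nth (1 + fps_const lam * R) (Suc i)" for i by simp
  hence step: "fps_nth H (Suc i) - fps_nth H i = lam * fps_nth R (Suc i)" for i
    by (simp add: right_diff_distrib)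
  have "lam * fps_nth R (Suc i) \<le> 0" for i
    using lam R_nonneg by (intro mult_nonpos_nonneg) auto
  hence dec: "decseq (fps_nth H)"
    using step by (intro decseq_SucI) (metis diff_le_0_iff_le)
  hence "convergent (fps_nth H)"
    using decseq_convergent[OF dec, of 0] H_nonneg convergentI by metis
  hence "convergent (\<lambda>i. b 0 * fps_nth H i)"
    by (intro convergent_mult convergent_const)
  hence "convergent_from (a + 1) y"
    by (simp add: convergent_from_def tends_to_from_def y convergent_def)
  moreover have "monotone_from (a + 1) y"
  proof (cases "b 0 \<ge> 0")
    case True
    have "antimono_on (Nfrom (a + 1)) y"
      using True dec by (auto simp: monotone_on_def Nfrom_def y decseq_def intro!: mult_left_mono)
    thus ?thesis by (simp add: monotone_from_def)
  next
    case False
    have "mono_on (Nfrom (a + 1)) y"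
      using False dec by (auto simp: monotone_on_def Nfrom_def y decseq_def intro!: mult_left_mono_neg)
    thus ?thesis by (simp add: monotone_from_def)
  qed
  ultimately show ?thesis by simp
qed

section \<open>Zero parameter\<close>

lemma one_minus_pow_minus_Suc_nth:
  "fps_nth (one_minus_pow (- 1 - real \<kappa>)) i = real (i + \<kappa> choose \<kappa>)"
proof -
  have "(-1 - real \<kappa>) gchoose i = (-1) ^ i * ((1 + real \<kappa> + real i - 1) gchoose i)"
    using gbinomial_minus[of "1 + real \<kappa>" i] by simp
  also have "1 + real \<kappa> + real i - 1 = real (i + \<kappa>)" by simp
  also have "real (i + \<kappa>) gchoose i = real (i + \<kappa> choose \<kappa>)"
    by (subst binomial_symmetric) (simp_all add: binomial_gbinomial)
  finally show ?thesis by (simp add: one_minus_pow_nth)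
qed

lemma zero_response:
  assumes "is_response n \<alpha> a 0 b y"
  shows "y (a + 1 + real i) = (\<Sum>\<kappa><n. b \<kappa> * real (i + \<kappa> choose \<kappa>))"
proof -
  have "one_minus_pow (- \<alpha>) * (one_minus_pow \<alpha> * nabla_gf 0 y a) =
      one_minus_pow (- \<alpha>) * (\<Sum>\<kappa><n. fps_const (b \<kappa>) * one_minus_pow (\<alpha> - 1 - real \<kappa>))"
    using assms by (simp add: is_response_iff_gf)
  moreover have "one_minus_pow (- \<alpha>) * (one_minus_pow \<alpha> * nabla_gf 0 y a) = nabla_gf 0 y a"
    by (simp flip: mult.assoc one_minus_pow_add)
  moreover have "one_minus_pow (- \<alpha>) * (fps_const (b \<kappa>) * one_minus_pow (\<alpha> - 1 - real \<kappa>)) =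
      fps_const (b \<kappa>) * one_minus_pow (- 1 - real \<kappa>)" for \<kappa>
  proof -
    have "one_minus_pow (- \<alpha>) * one_minus_pow (\<alpha> - 1 - real \<kappa>) = one_minus_pow (- 1 - real \<kappa>)"
      by (simp flip: one_minus_pow_add)
    thus ?thesis by (metis mult.left_commute)
  qed
  ultimately have "nabla_gf 0 y a = (\<Sum>\<kappa><n. fps_const (b \<kappa>) * one_minus_pow (- 1 - real \<kappa>))"
    by (simp add: sum_distrib_left)
  from arg_cong[OF this, of "\<lambda>F. fps_nth F i"] show ?thesis
    by (simp add: fps_sum_nth one_minus_pow_minus_Suc_nth)
qed

lemma rising_eq_binomial:
  "rising (1 + real i) (real \<kappa>) / fact \<kappa> = real (i + \<kappa> choose \<kappa>)"
proof -
  have "Gamma (1 + real i + real \<kappa>) = fact (i + \<kappa>)"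
    using Gamma_fact[of "i + \<kappa>", where 'a=real] by (simp add: add_ac)
  thus ?thesis by (simp add: rising_def Gamma_fact binomial_fact)
qed

text \<open>
  The differences of a convergent sequence tend to \<open>0\<close>. By Pascal's rule, those of such a combination
  form a combination of the same kind with coefficients shifted down by one, so induction on the
  degree kills all coefficients but the first.
\<close>
lemma binomial_combination_convergent_imp_constant:
  fixes c :: "nat \<Rightarrow> real"
  assumes "(\<lambda>i. \<Sum>\<kappa><m. c \<kappa> * real (i + \<kappa> choose \<kappa>)) \<longlonglongrightarrow> L"
  shows "\<forall>\<kappa><m. c \<kappa> = (if \<kappa> = 0 then L else 0)"
  using assms
proof (induction m arbitrary: c L)
  case (Suc m)
  define x where "x i = (\<Sum>\<kappa><Suc m. c \<kappa> * real (i + \<kappa> choose \<kappa>))" for i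
  have x: "x \<longlonglongrightarrow> L" using Suc.prems by (simp add: x_def[abs_def])
  have "(\<lambda>i. x (Suc i) - x i) \<longlonglongrightarrow> L - L"
    by (intro tendsto_diff LIMSEQ_Suc x)
  moreover have "x (Suc i) - x i = (\<Sum>\<kappa><m. c (Suc \<kappa>) * real (Suc i + \<kappa> choose \<kappa>))" for i
    unfolding x_def sum.lessThan_Suc_shift by (simp add: algebra_simps sum.distrib flip: sum_subtractf)
  ultimately have "(\<lambda>i. \<Sum>\<kappa><m. c (Suc \<kappa>) * real (Suc i + \<kappa> choose \<kappa>)) \<longlonglongrightarrow> 0" by simp
  hence "(\<lambda>i. \<Sum>\<kappa><m. c (Suc \<kappa>) * real (i + \<kappa> choose \<kappa>)) \<longlonglongrightarrow> 0"
    by (rule LIMSEQ_imp_Suc)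
  from Suc.IH[OF this] have shifted: "c (Suc \<kappa>) = 0" if "\<kappa> < m" for \<kappa>
    using that by auto
  hence "x = (\<lambda>_. c 0)" unfolding x_def sum.lessThan_Suc_shift by (intro ext) simp
  hence "c 0 = L" using x LIMSEQ_unique[OF tendsto_const] by metis
  thus ?case using shifted by (auto simp: less_Suc_eq_0_disj)
qed simp

lemma zero_response_divergent_or_constant:
  assumes "is_response n \<alpha> a 0 b y"
  shows "divergent_from (a + 1) y \<or> y constant_on Nfrom (a + 1)"
proof (cases "divergent_from (a + 1) y")
  case False
  then obtain L where "(\<lambda>i. y (a + 1 + real i)) \<longlonglongrightarrow> L"
    by (auto simp: divergent_from_def convergent_from_def tends_to_from_def)
  hence "\<forall>\<kappa><n. b \<kappa> = (if \<kappa> = 0 then L else 0)"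
    unfolding zero_response[OF assms] by (rule binomial_combination_convergent_imp_constant)
  hence "y (a + 1 + real i) = (\<Sum>\<kappa><n. if \<kappa> = 0 then L else 0)" for i
    unfolding zero_response[OF assms] by (intro sum.cong) auto
  thus ?thesis by (auto simp: constant_on_def Nfrom_def)
qed simp

lemma nabla_zero_fun: "nabla n (\<lambda>_. 0) k = 0"
  by (simp add: nabla_def)

lemma zero_fun_is_response: "is_response n \<alpha> a lam (\<lambda>_. 0) (\<lambda>_. 0)"
  by (simp add: is_response_def nabla_caputo_def nabla_fsum_def nabla_zero_fun)

lemma nabla_linear: "nabla (Suc (Suc n)) (\<lambda>k. k - c) k = 0"
proof (induction n arbitrary: k)
  case 0
  show ?case by (simp add: nabla_Suc)
next
  case (Suc n)
  show ?case by (subst nabla_Suc) (simp only: Suc.IH diff_self)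
qed

lemma linear_is_zero_response:
  assumes "n \<ge> 2"
  shows "is_response n \<alpha> a 0 (\<lambda>\<kappa>. nabla \<kappa> (\<lambda>k. k - a) a) (\<lambda>k. k - a)"
proof -
  obtain m where "n = Suc (Suc m)" using assms by (metis Suc_le_D numeral_2_eq_2 Suc_le_mono)
  thus ?thesis by (simp add: is_response_def nabla_caputo_def nabla_fsum_def nabla_linear)
qed

lemma linear_divergent: "divergent_from (a + 1) (\<lambda>k. k - a)"
  unfolding divergent_from_def
proof
  assume "convergent_from (a + 1) (\<lambda>k. k - a)"
  then obtain L where "(\<lambda>i. 1 + real i) \<longlonglongrightarrow> L"
    by (auto simp: convergent_from_def tends_to_from_def)
  hence "(\<lambda>i. 1 + real i - 1) \<longlonglongrightarrow> L - 1" by (intro tendsto_diff tendsto_const)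
  moreover have "filterlim real at_infinity sequentially"
    by (rule filterlim_at_top_imp_at_infinity[OF filterlim_real_sequentially])
  ultimately show False
    using not_tendsto_and_filterlim_at_infinity[of sequentially real "L - 1"] by simp
qed

section \<open>An overshooting response\<close>

lemma start_plus_in_Nfrom: "c + real i \<in> Nfrom c"
  by (auto simp: Nfrom_def)

text \<open>
  The values before \<open>a + 1\<close> are forced by \<open>b\<close>; the later ones are read off the generating function.
\<close>
lemma order_two_response_exists:
  fixes b :: "nat \<Rightarrow> real"
  assumes lam: "lam \<noteq> 1"
  obtains y where "is_response 2 \<alpha> a lam b y"
proof -
  define D where "D = one_minus_pow \<alpha> - fps_const lam"
  define N where "N = (\<Sum>\<kappa><2. fps_const (b \<kappa>) * one_minus_pow (\<alpha> - 1 - real \<kappa>))"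
  define Z where "Z = inverse D * N"
  define y where "y x = (if x = a - 1 then b 0 - b 1 else if x = a then b 0
    else fps_nth Z (nat \<lfloor>x - a - 1\<rfloor>))" for x
  have "inverse D * D = 1" using lam by (intro inverse_mult_eq_1) (simp add: D_def)
  hence DZ: "D * Z = N" by (simp add: Z_def mult.assoc [symmetric] mult.commute[of D])
  have "nabla_gf 0 y a = Z" by (rule fps_ext) (simp add: y_def)
  moreover have "nabla \<kappa> y a = b \<kappa>" if "\<kappa> < 2" for \<kappa>
    using that by (auto simp: numeral_2_eq_2 less_Suc_eq nabla_Suc y_def)
  ultimately have "is_response 2 \<alpha> a lam b y"
    using DZ by (simp only: is_response_iff_gf D_def N_def) simp
  thus thesis by (rule that)
qed

text \<open>
  The limit is \<open>0\<close>, and the first two values \<open>y (a + 1)\<close> and \<open>y (a + 2)\<close> depend on \<open>b 0\<close> and \<open>b 1\<close> through an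
  invertible linear system, so they may be prescribed to be \<open>1\<close> and \<open>-1\<close>.
\<close>
lemma overshooting_response_exists:
  assumes "1 < \<alpha>" "\<alpha> < 2" "lam < 0"
  shows "\<exists>b y. is_response 2 \<alpha> a lam b y \<and> overshoots_from (a + 1) y"
proof -
  \<comment> \<open>The solution of the linear system for the first two values \<open>1\<close> and \<open>-1\<close>.\<close>
  define b1 where "b1 = (\<alpha> - 2) * (1 - lam) - \<alpha>"
  define b where "b \<kappa> = (if \<kappa> = 0 then 1 - lam - b1 else b1)" for \<kappa> :: nat
  obtain y where resp: "is_response 2 \<alpha> a lam b y"
    using order_two_response_exists[of lam \<alpha> a b] assms by auto
  define Z where "Z = nabla_gf 0 y a"
  have eq: "(one_minus_pow \<alpha> - fps_const lam) * Z =
      fps_const (b 0) * one_minus_pow (\<alpha> - 1) + fps_const (b 1) * one_minus_pow (\<alpha> - 1 - 1)"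
    using resp by (simp add: is_response_iff_gf Z_def numeral_2_eq_2)
  have "fps_nth ((one_minus_pow \<alpha> - fps_const lam) * Z) 0 = b 0 + b 1"
    unfolding eq by simp
  hence "(1 - lam) * fps_nth Z 0 = (1 - lam) * 1" by (simp add: b_def)
  hence Z0: "fps_nth Z 0 = 1" using assms by simp
  have "fps_nth ((one_minus_pow \<alpha> - fps_const lam) * Z) 1 =
      - (b 0 * (\<alpha> - 1) + b 1 * (\<alpha> - 2))"
    unfolding eq by (simp add: one_minus_pow_nth algebra_simps)
  hence "(1 - lam) * fps_nth Z 1 - \<alpha> * fps_nth Z 0 = - (b 0 * (\<alpha> - 1) + b 1 * (\<alpha> - 2))"
    by (simp add: fps_mult_nth_1 one_minus_pow_nth)
  also have "\<dots> = (1 - lam) * (-1) - \<alpha>"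
    by (simp add: b_def b1_def algebra_simps)
  finally have "(1 - lam) * fps_nth Z 1 = (1 - lam) * (-1)" using Z0 by simp
  hence Z1: "fps_nth Z 1 = -1" unfolding mult_cancel_left using assms by auto
  have lim: "tends_to_from (a + 1) y 0"
    using neg_response_tendsto_0[OF resp] assms by simp
  have "a + 1 \<in> Nfrom (a + 1)" "a + 1 + 1 \<in> Nfrom (a + 1)"
    using start_plus_in_Nfrom[of "a + 1" 0] start_plus_in_Nfrom[of "a + 1" 1] by simp_all
  moreover have "y (a + 1) = 1" "y (a + 1 + 1) = -1"
    using Z0 Z1 by (simp_all add: Z_def)
  ultimately have "overshoots_from (a + 1) y"
    using lim unfolding overshoots_from_def
    by (intro exI[of _ 0] conjI bexI[of _ "a + 1 + 1"] bexI[of _ "a + 1"]) auto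
  thus ?thesis using resp by blast
qed

lemma zero_fun_not_overshoots: "\<not> overshoots_from c (\<lambda>_. 0)"
  by (auto simp: overshoots_from_def)

theorem theorem5:
  fixes n :: nat and \<alpha> a lam :: real and b :: "nat \<Rightarrow> real" and y :: "real \<Rightarrow> real"
  assumes "n \<ge> 1" and "real n - 1 < \<alpha>" and "\<alpha> < real n" and "lam \<noteq> 1"
    and "is_response n \<alpha> a lam b y"
  shows
    "(lam > 0 \<longrightarrow>
        (lam < 2 powr \<alpha> \<longrightarrow> mode_amplitude n b (principal_root \<alpha> lam) \<noteq> 0 \<longrightarrow>
           divergent_from (a + 1) y) \<and>
        (lam > 2 powr \<alpha> \<longrightarrow> convergent_from (a + 1) y))
     \<and>
     (lam = 0 \<longrightarrow>
        (\<forall>k \<in> Nfrom (a + 1). y k = (\<Sum>\<kappa> = 0..n - 1. b \<kappa> / fact \<kappa> * rising (k - a) (real \<kappa>))) \<and>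
        (divergent_from (a + 1) y \<or> y constant_on Nfrom (a + 1)) \<and>
        (\<exists>b' y'. is_response n \<alpha> a lam b' y' \<and> y' constant_on Nfrom (a + 1)) \<and>
        (n \<ge> 2 \<longrightarrow> (\<exists>b' y'. is_response n \<alpha> a lam b' y' \<and> divergent_from (a + 1) y')))
     \<and>
     (lam < 0 \<longrightarrow>
        (0 < \<alpha> \<and> \<alpha> \<le> 1 \<longrightarrow> monotone_from (a + 1) y \<and> convergent_from (a + 1) y) \<and>
        (1 < \<alpha> \<and> \<alpha> \<le> 2 \<longrightarrow>
           convergent_from (a + 1) y \<and>
           (\<exists>b' y'. is_response n \<alpha> a lam b' y' \<and> overshoots_from (a + 1) y') \<and>
           (\<exists>b' y'. is_response n \<alpha> a lam b' y' \<and> \<not> overshoots_from (a + 1) y')) \<and>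
        (\<alpha> > 2 \<longrightarrow>
           (\<bar>lam\<bar> < 2 powr \<alpha> * cos (pi / \<alpha>) powr \<alpha> \<longrightarrow>
              mode_amplitude n b (principal_root \<alpha> lam) \<noteq> 0 \<longrightarrow> divergent_from (a + 1) y) \<and>
           (\<bar>lam\<bar> > 2 powr \<alpha> * cos (pi / \<alpha>) powr \<alpha> \<longrightarrow> convergent_from (a + 1) y)))"
proof -
  have \<alpha>: "\<alpha> > 0" using assms by simp
  note resp = \<open>is_response n \<alpha> a lam b y\<close>
  have divergence: "divergent_from (a + 1) y"
    if "lam \<noteq> 0" "lam < 0 \<Longrightarrow> \<alpha> \<ge> 1" "norm (principal_root \<alpha> lam - 1) < 1"
      "mode_amplitude n b (principal_root \<alpha> lam) \<noteq> 0"
    using excited_mode_imp_divergent[OF resp that(3) principal_root_powr that(4)] that \<alpha> by blast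
  have formula: "y k = (\<Sum>\<kappa> = 0..n - 1. b \<kappa> / fact \<kappa> * rising (k - a) (real \<kappa>))"
    if "lam = 0" and k: "k \<in> Nfrom (a + 1)" for k
  proof -
    obtain i where i: "k = a + 1 + real i" using k by (auto simp: Nfrom_def)
    have "{0..n - 1} = {..<n}" using \<open>n \<ge> 1\<close> by auto
    moreover have "b \<kappa> / fact \<kappa> * rising (k - a) (real \<kappa>) = b \<kappa> * real (i + \<kappa> choose \<kappa>)" for \<kappa>
      by (simp add: i flip: rising_eq_binomial)
    ultimately show ?thesis
      using zero_response[of n \<alpha> a b y i] resp \<open>lam = 0\<close> i by simp
  qed
  have zero: "is_response n \<alpha> a lam (\<lambda>_. 0) (\<lambda>_. 0)" by (rule zero_fun_is_response)
  have const: "(\<lambda>_. 0 :: real) constant_on Nfrom (a + 1)" by (auto simp: constant_on_def)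
  have n1: "n = 1" if "\<alpha> \<le> 1" using assms that by simp
  have n2: "n = 2" if "1 < \<alpha>" "\<alpha> \<le> 2"
  proof -
    have "real n < 3" "real n > 1" using assms that by linarith+
    thus ?thesis by linarith
  qed
  have neg_conv: "convergent_from (a + 1) y"
    if "lam < 0" "\<alpha> > 1" "\<alpha> > 2 \<Longrightarrow> \<bar>lam\<bar> > 2 powr \<alpha> * cos (pi / \<alpha>) powr \<alpha>"
    using neg_response_tendsto_0[OF resp \<open>real n - 1 < \<alpha>\<close> that(2,1,3)] by (auto simp: convergent_from_def)
  show ?thesis
  proof (intro conjI impI)
    assume "0 < lam" "lam < 2 powr \<alpha>" "mode_amplitude n b (principal_root \<alpha> lam) \<noteq> 0"
    thus "divergent_from (a + 1) y" using \<alpha> by (intro divergence pos_root_in_disc) auto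
  next
    assume "2 powr \<alpha> < lam"
    thus "convergent_from (a + 1) y"
      using pos_response_tendsto_0[OF resp \<open>real n - 1 < \<alpha>\<close> \<alpha>] by (auto simp: convergent_from_def)
  next
    assume "lam = 0"
    thus "\<forall>k\<in>Nfrom (a + 1). y k = (\<Sum>\<kappa> = 0..n - 1. b \<kappa> / fact \<kappa> * rising (k - a) (real \<kappa>))"
      using formula by blast
  next
    assume "lam = 0"
    thus "divergent_from (a + 1) y \<or> y constant_on Nfrom (a + 1)"
      using zero_response_divergent_or_constant resp by blast
  next
    show "\<exists>b' y'. is_response n \<alpha> a lam b' y' \<and> y' constant_on Nfrom (a + 1)"
      using zero const by blast
  next
    assume "lam = 0" "2 \<le> n"
    thus "\<exists>b' y'. is_response n \<alpha> a lam b' y' \<and> divergent_from (a + 1) y'"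
      using linear_is_zero_response linear_divergent by blast
  next
    assume "lam < 0" "0 < \<alpha> \<and> \<alpha> \<le> 1"
    hence "n = 1" by (intro n1) simp
    hence "\<alpha> < 1" and resp': "is_response 1 \<alpha> a lam b y"
      using resp \<open>\<alpha> < real n\<close> by simp_all
    from \<open>lam < 0\<close> show "monotone_from (a + 1) y" "convergent_from (a + 1) y"
      using order_below_one_monotone_convergent[OF resp'] \<open>\<alpha> < 1\<close> \<alpha> by blast+
  next
    assume "lam < 0" "1 < \<alpha> \<and> \<alpha> \<le> 2"
    thus "convergent_from (a + 1) y" by (intro neg_conv) auto
  next
    assume "lam < 0" and *: "1 < \<alpha> \<and> \<alpha> \<le> 2"
    thus "\<exists>b' y'. is_response n \<alpha> a lam b' y' \<and> overshoots_from (a + 1) y'"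
      using overshooting_response_exists[of \<alpha> lam a] n2 \<open>\<alpha> < real n\<close> by auto
  next
    show "\<exists>b' y'. is_response n \<alpha> a lam b' y' \<and> \<not> overshoots_from (a + 1) y'"
      using zero zero_fun_not_overshoots by blast
  next
    assume "lam < 0" "2 < \<alpha>" "\<bar>lam\<bar> < 2 powr \<alpha> * cos (pi / \<alpha>) powr \<alpha>"
      "mode_amplitude n b (principal_root \<alpha> lam) \<noteq> 0"
    thus "divergent_from (a + 1) y" by (intro divergence neg_root_in_disc) auto
  next
    assume "lam < 0" "2 < \<alpha>" "2 powr \<alpha> * cos (pi / \<alpha>) powr \<alpha> < \<bar>lam\<bar>"
    thus "convergent_from (a + 1) y" by (intro neg_conv) auto
  qed
qed

end
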